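(* Let $\lambda\in\Lambda^+\setminus\{0\}$ and let $q\in\mathbb{Q}_{>0}$ be such that $q\lambda\in\Lambda^+$. If $d_1(q\lambda)$ exists (i.e. if there is a nonzero $K$-invariant homogeneous polynomial of positive degree on $V_{q\lambda}$), then $${\bf r}_0(\lambda)\leq d_1(q\lambda).$$
   Context: $K$ is a semisimple connected compact Lie group with Lie algebra $\mathfrak{k}$. Let $(\cdot|\cdot)$ be the negative of the Killing form of $\mathfrak{k}$, which is a positive definite $K$-invariant inner product; it is used to identify $\mathfrak{k}\cong\mathfrak{k}^*$. Fix a maximal abelian subalgebra $\mathfrak{t}\subset\mathfrak{k}$ and a closed Weyl chamber $\mathfrak{t}_+\subset\mathfrak{t}$, and let $T=\exp(\mathfrak{t})$ be the corresponding maximal torus. For $\lambda\in\mathfrak{t}_+$, $K\lambda\subset\mathfrak{k}$ denotes the (co)adjoint orbit of $\lambda$. The weight lattice $\Lambda\subset\mathfrak{t}$ of $T$ is the image of the character lattice $\mathrm{Hom}(T,\mathbb{C}^\times)$, embedded in $i\mathfrak{t}^*$ via differentials, under multiplication by $-i$ followed by the identification $\mathfrak{t}^*\cong\mathfrak{t}$ given by $(\cdot|\cdot)$. The set of dominant weights is $\Lambda^+=\Lambda\cap\mathfrak{t}_+$. For $\lambda\in\Lambda^+$, $V_\lambda$ denotes the irreducible complex representation of $K$ with highest weight $i(\lambda|\cdot)$. $\mathbb{C}[V_\lambda]$ is the ring of polynomials on $V_\lambda$, $\mathbb{C}[V_\lambda]_d$ its subspace of homogeneous polynomials of degree $d$,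 and $\mathbb{C}[V_\lambda]_d^K$ the subspace of $K$-invariants. Set $$d_1(\lambda)=\min\{d\in\mathbb{Z}_{>0}:\mathbb{C}[V_\lambda]_d^K\neq 0\},$$ whenever this minimum exists. For a positive integer $r$ and a subset $X$ of a Euclidean space, the $r$-th partial convex hull is $C_r(X)=\bigcup_{x_1,\dots,x_r\in X}\mathrm{Conv}\{x_1,\dots,x_r\}$, where the $x_j$ need not be distinct. For $\lambda\in\mathfrak{t}_+$, $${\bf r}_0(\lambda)=\min\{r\in\mathbb{N}: 0\in C_r(K\lambda)\},$$ where $\mathbb{N}$ denotes the positive integers. This is well defined since $0\in\mathrm{Conv}(K\lambda)$, because $K$ is semisimple. *)

theory Defs
  imports "HOL-Analysis.Analysis" "HOL-Algebra.Group"
begin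

section \<open>Smooth maps between open subsets of normed spaces\<close>

text \<open>The clauses ask for directional derivatives of all orders; on finite-dimensional domains
  this is the usual \<open>C\<^sup>k\<close>.  The set \<open>S\<close> is always open below.\<close>

primrec Ck_on :: "nat \<Rightarrow> ('a::real_normed_vector \<Rightarrow> 'b::real_normed_vector) \<Rightarrow> 'a set \<Rightarrow> bool" where
  "Ck_on 0 f S \<longleftrightarrow> continuous_on S f"
| "Ck_on (Suc k) f S \<longleftrightarrow> (\<forall>x\<in>S. f differentiable (at x)) \<and>
     (\<forall>v. Ck_on k (\<lambda>x. frechet_derivative f (at x) v) S)"

definition smooth_on :: "('a::real_normed_vector \<Rightarrow> 'b::real_normed_vector) \<Rightarrow> 'a set \<Rightarrow> bool" where
  "smooth_on f S \<longleftrightarrow> (\<forall>k. Ck_on k f S)"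


section \<open>Lie groups\<close>

text \<open>A chart is a pair \<open>(U, \<phi>)\<close> of its domain and its coordinate map.  The model space is the
  Euclidean space \<open>'e\<close>, hence of positive dimension.\<close>

type_synonym ('g, 'e) chart = "'g set \<times> ('g \<Rightarrow> 'e)"

definition chart_inv :: "('g, 'e) chart \<Rightarrow> 'e \<Rightarrow> 'g" where
  "chart_inv c = inv_into (fst c) (snd c)"

definition chart_image :: "('g, 'e) chart \<Rightarrow> 'e set" where
  "chart_image c = snd c ` fst c"

definition is_chart :: "'g topology \<Rightarrow> ('g, 'e::euclidean_space) chart \<Rightarrow> bool" where
  "is_chart T c \<longleftrightarrow> openin T (fst c) \<and> open (chart_image c) \<and>
     homeomorphic_map (subtopology T (fst c)) (top_of_set (chart_image c)) (snd c)"

record ('g, 'e) lie_struct = "'g monoid" +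
  gtop :: "'g topology"
  atlas :: "('g, 'e) chart set"

locale lie_group = group K for K :: "('g, 'e::euclidean_space) lie_struct" (structure) +
  assumes topspace_eq: "topspace (gtop K) = carrier K"
    and Hausdorff: "Hausdorff_space (gtop K)"
    and second_countable: "second_countable (gtop K)"
    and charts: "c \<in> atlas K \<Longrightarrow> is_chart (gtop K) c"
    and cover: "(\<Union>c\<in>atlas K. fst c) = carrier K"
    and transition: "c \<in> atlas K \<Longrightarrow> c' \<in> atlas K \<Longrightarrow>
      smooth_on (snd c' \<circ> chart_inv c) (snd c ` (fst c \<inter> fst c'))"
    and mult_continuous:
      "continuous_map (prod_topology (gtop K) (gtop K)) (gtop K) (\<lambda>(x, y). x \<otimes> y)"
    and mult_smooth: "c1 \<in> atlas K \<Longrightarrow> c2 \<in> atlas K \<Longrightarrow> c3 \<in> atlas K \<Longrightarrow>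
      smooth_on (\<lambda>(x, y). snd c3 (chart_inv c1 x \<otimes> chart_inv c2 y))
        {(x, y). x \<in> chart_image c1 \<and> y \<in> chart_image c2 \<and>
                 chart_inv c1 x \<otimes> chart_inv c2 y \<in> fst c3}"
    and inv_continuous: "continuous_map (gtop K) (gtop K) (\<lambda>x. inv x)"
    and inv_smooth: "c1 \<in> atlas K \<Longrightarrow> c2 \<in> atlas K \<Longrightarrow>
      smooth_on (\<lambda>x. snd c2 (inv (chart_inv c1 x)))
        {x. x \<in> chart_image c1 \<and> inv (chart_inv c1 x) \<in> fst c2}"

definition smooth_map_on_group ::
    "('g, 'e::euclidean_space) lie_struct \<Rightarrow> ('g \<Rightarrow> 'b::real_normed_vector) \<Rightarrow> bool" where
  "smooth_map_on_group K f \<longleftrightarrow> (\<forall>c\<in>atlas K. smooth_on (f \<circ> chart_inv c) (chart_image c))"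


section \<open>The Lie algebra\<close>

text \<open>The tangent space at the identity is identified with \<open>'e\<close> by means of a chart around the
  identity, selected once and for all.  Another choice gives an isomorphic Lie algebra.\<close>

definition id_chart :: "('g, 'e) lie_struct \<Rightarrow> ('g, 'e) chart" where
  "id_chart K = (SOME c. c \<in> atlas K \<and> \<one>\<^bsub>K\<^esub> \<in> fst c)"

definition id_point :: "('g, 'e) lie_struct \<Rightarrow> 'e" where
  "id_point K = snd (id_chart K) \<one>\<^bsub>K\<^esub>"

definition deriv_at_one ::
    "('g, 'e::euclidean_space) lie_struct \<Rightarrow> ('g \<Rightarrow> 'b::real_normed_vector) \<Rightarrow> 'e \<Rightarrow> 'b" where
  "deriv_at_one K f = frechet_derivative (f \<circ> chart_inv (id_chart K)) (at (id_point K))"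

definition Ad :: "('g, 'e::euclidean_space) lie_struct \<Rightarrow> 'g \<Rightarrow> 'e \<Rightarrow> 'e" where
  "Ad K g = deriv_at_one K (\<lambda>x. snd (id_chart K) (g \<otimes>\<^bsub>K\<^esub> x \<otimes>\<^bsub>K\<^esub> inv\<^bsub>K\<^esub> g))"

text \<open>The bracket is given by \<open>[X, Y] = ad X Y\<close>, where \<open>ad\<close> is the differential of \<open>Ad\<close>.\<close>

definition bracket :: "('g, 'e::euclidean_space) lie_struct \<Rightarrow> 'e \<Rightarrow> 'e \<Rightarrow> 'e" where
  "bracket K X Y = deriv_at_one K (\<lambda>g. Ad K g Y) X"

definition endo_trace :: "('e::euclidean_space \<Rightarrow> 'e) \<Rightarrow> real" where
  "endo_trace f = (\<Sum>b\<in>Basis. f b \<bullet> b)"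

definition killing_form :: "('g, 'e::euclidean_space) lie_struct \<Rightarrow> 'e \<Rightarrow> 'e \<Rightarrow> real" where
  "killing_form K X Y = endo_trace (bracket K X \<circ> bracket K Y)"

text \<open>The form \<open>(X|Y)\<close>.  The inner product of the model space \<open>'e\<close> plays no role.\<close>

definition kform :: "('g, 'e::euclidean_space) lie_struct \<Rightarrow> 'e \<Rightarrow> 'e \<Rightarrow> real" where
  "kform K X Y = - killing_form K X Y"

definition lie_ideal :: "('g, 'e::euclidean_space) lie_struct \<Rightarrow> 'e set \<Rightarrow> bool" where
  "lie_ideal K I \<longleftrightarrow> subspace I \<and> (\<forall>X. \<forall>Y\<in>I. bracket K X Y \<in> I)"

definition derived_algebra :: "('g, 'e::euclidean_space) lie_struct \<Rightarrow> 'e set \<Rightarrow> 'e set" where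
  "derived_algebra K S = span {bracket K X Y | X Y. X \<in> S \<and> Y \<in> S}"

definition lie_solvable :: "('g, 'e::euclidean_space) lie_struct \<Rightarrow> 'e set \<Rightarrow> bool" where
  "lie_solvable K S \<longleftrightarrow> (\<exists>n. (derived_algebra K ^^ n) S = {0})"

definition semisimple :: "('g, 'e::euclidean_space) lie_struct \<Rightarrow> bool" where
  "semisimple K \<longleftrightarrow> (\<forall>I. lie_ideal K I \<and> lie_solvable K I \<longrightarrow> I = {0})"

definition abelian_subalgebra :: "('g, 'e::euclidean_space) lie_struct \<Rightarrow> 'e set \<Rightarrow> bool" where
  "abelian_subalgebra K t \<longleftrightarrow> subspace t \<and> (\<forall>X\<in>t. \<forall>Y\<in>t. bracket K X Y = 0)"

definition maximal_abelian :: "('g, 'e::euclidean_space) lie_struct \<Rightarrow> 'e set \<Rightarrow> bool" where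
  "maximal_abelian K t \<longleftrightarrow> abelian_subalgebra K t \<and>
     (\<forall>s. abelian_subalgebra K s \<and> t \<subseteq> s \<longrightarrow> s = t)"

definition adjoint_orbit :: "('g, 'e::euclidean_space) lie_struct \<Rightarrow> 'e \<Rightarrow> 'e set" where
  "adjoint_orbit K X = (\<lambda>g. Ad K g X) ` carrier K"


section \<open>Roots and Weyl chambers\<close>

text \<open>Roots are elements of \<open>t\<close> via \<open>(\<cdot>|\<cdot>)\<close>, with the factor \<open>\<i>\<close> removed as for weights.  The
  vector \<open>X + \<i>Y\<close> of the complexified Lie algebra has root \<open>\<alpha>\<close> if
  \<open>[H, X + \<i>Y] = \<i>(\<alpha>|H)(X + \<i>Y)\<close> for all \<open>H \<in> t\<close>; the definition lists real and imaginary part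
  of this equation.\<close>

definition in_root_space ::
    "('g, 'e::euclidean_space) lie_struct \<Rightarrow> 'e set \<Rightarrow> 'e \<Rightarrow> 'e \<Rightarrow> 'e \<Rightarrow> bool" where
  "in_root_space K t \<alpha> X Y \<longleftrightarrow>
     (\<forall>H\<in>t. bracket K H X = - (kform K \<alpha> H *\<^sub>R Y) \<and> bracket K H Y = kform K \<alpha> H *\<^sub>R X)"

definition roots :: "('g, 'e::euclidean_space) lie_struct \<Rightarrow> 'e set \<Rightarrow> 'e set" where
  "roots K t = {\<alpha>\<in>t. \<alpha> \<noteq> 0 \<and> (\<exists>X Y. (X, Y) \<noteq> (0, 0) \<and> in_root_space K t \<alpha> X Y)}"

definition closed_weyl_chamber ::
    "('g, 'e::euclidean_space) lie_struct \<Rightarrow> 'e set \<Rightarrow> 'e set \<Rightarrow> bool" where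
  "closed_weyl_chamber K t tp \<longleftrightarrow>
     (\<exists>C \<in> components {H\<in>t. \<forall>\<alpha>\<in>roots K t. kform K \<alpha> H \<noteq> 0}. tp = closure C)"

definition positive_roots ::
    "('g, 'e::euclidean_space) lie_struct \<Rightarrow> 'e set \<Rightarrow> 'e set \<Rightarrow> 'e set" where
  "positive_roots K t tp = {\<alpha>\<in>roots K t. \<forall>H\<in>tp. kform K \<alpha> H \<ge> 0}"


section \<open>The maximal torus and the weight lattice\<close>

definition one_parameter_subgroup ::
    "('g, 'e::euclidean_space) lie_struct \<Rightarrow> 'e \<Rightarrow> (real \<Rightarrow> 'g) \<Rightarrow> bool" where
  "one_parameter_subgroup K X \<gamma> \<longleftrightarrow>
     continuous_map euclideanreal (gtop K) \<gamma> \<and> (\<forall>s u. \<gamma> (s + u) = \<gamma> s \<otimes>\<^bsub>K\<^esub> \<gamma> u) \<and>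
     ((snd (id_chart K) \<circ> \<gamma>) has_vector_derivative X) (at 0)"

definition lie_exp :: "('g, 'e::euclidean_space) lie_struct \<Rightarrow> 'e \<Rightarrow> 'g" where
  "lie_exp K X = (THE \<gamma>. one_parameter_subgroup K X \<gamma>) 1"

definition torus :: "('g, 'e::euclidean_space) lie_struct \<Rightarrow> 'e set \<Rightarrow> 'g set" where
  "torus K t = lie_exp K ` t"

definition torus_character ::
    "('g, 'e::euclidean_space) lie_struct \<Rightarrow> 'e set \<Rightarrow> ('g \<Rightarrow> complex) \<Rightarrow> bool" where
  "torus_character K t \<psi> \<longleftrightarrow>
     continuous_map (subtopology (gtop K) (torus K t)) euclidean \<psi> \<and>
     (\<forall>x\<in>torus K t. \<psi> x \<noteq> 0) \<and>
     (\<forall>x\<in>torus K t. \<forall>y\<in>torus K t. \<psi> (x \<otimes>\<^bsub>K\<^esub> y) = \<psi> x * \<psi> y)"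

definition weight_lattice :: "('g, 'e::euclidean_space) lie_struct \<Rightarrow> 'e set \<Rightarrow> 'e set" where
  "weight_lattice K t = {\<mu>\<in>t. \<exists>\<psi>. torus_character K t \<psi> \<and>
     (\<forall>X\<in>t. ((\<lambda>s. \<psi> (lie_exp K (s *\<^sub>R X))) has_vector_derivative
               \<i> * complex_of_real (kform K \<mu> X)) (at 0))}"

definition dominant_weights ::
    "('g, 'e::euclidean_space) lie_struct \<Rightarrow> 'e set \<Rightarrow> 'e set \<Rightarrow> 'e set" where
  "dominant_weights K t tp = weight_lattice K t \<inter> tp"


section \<open>Representations\<close>

text \<open>Complex representations on \<open>\<complex>\<^sup>n\<close>, given by matrices.  Smoothness is part of the notion of a
  Lie group homomorphism to \<open>GL(n, \<complex>)\<close>; it is automatic for continuous homomorphisms.\<close>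

definition lie_rep ::
    "('g, 'e::euclidean_space) lie_struct \<Rightarrow> ('g \<Rightarrow> complex^'n^'n) \<Rightarrow> bool" where
  "lie_rep K \<rho> \<longleftrightarrow> \<rho> \<one>\<^bsub>K\<^esub> = mat 1 \<and>
     (\<forall>g\<in>carrier K. \<forall>h\<in>carrier K. \<rho> (g \<otimes>\<^bsub>K\<^esub> h) = \<rho> g ** \<rho> h) \<and> smooth_map_on_group K \<rho>"

definition irreducible_rep ::
    "('g, 'e::euclidean_space) lie_struct \<Rightarrow> ('g \<Rightarrow> complex^'n^'n) \<Rightarrow> bool" where
  "irreducible_rep K \<rho> \<longleftrightarrow> lie_rep K \<rho> \<and>
     (\<forall>W. vec.subspace W \<and> (\<forall>g\<in>carrier K. \<forall>w\<in>W. \<rho> g *v w \<in> W) \<longrightarrow> W = {0} \<or> W = UNIV)"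

text \<open>The highest weight is \<open>\<i>(\<mu>|\<cdot>)\<close>: it is the weight of a nonzero vector which is annihilated
  by all root vectors \<open>X + \<i>Y\<close> for positive roots.\<close>

definition has_highest_weight ::
    "('g, 'e::euclidean_space) lie_struct \<Rightarrow> 'e set \<Rightarrow> 'e set \<Rightarrow> ('g \<Rightarrow> complex^'n^'n) \<Rightarrow> 'e \<Rightarrow> bool"
  where
  "has_highest_weight K t tp \<rho> \<mu> \<longleftrightarrow> (\<exists>v. v \<noteq> 0 \<and>
     (\<forall>H\<in>t. deriv_at_one K \<rho> H *v v = (\<i> * complex_of_real (kform K \<mu> H)) *s v) \<and>
     (\<forall>\<alpha>\<in>positive_roots K t tp. \<forall>X Y. in_root_space K t \<alpha> X Y \<longrightarrow>
        deriv_at_one K \<rho> X *v v + \<i> *s (deriv_at_one K \<rho> Y *v v) = 0))"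


section \<open>Invariant polynomials\<close>

definition homogeneous_polys :: "nat \<Rightarrow> (complex^'n \<Rightarrow> complex) set" where
  "homogeneous_polys d =
     {f. \<exists>c :: ('n \<Rightarrow> nat) \<Rightarrow> complex.
        f = (\<lambda>z. \<Sum>a | (\<Sum>i\<in>UNIV. a i) = d. c a * (\<Prod>i\<in>UNIV. (z $ i) ^ a i))}"

definition invariant_polys ::
    "('g, 'e::euclidean_space) lie_struct \<Rightarrow> ('g \<Rightarrow> complex^'n^'n) \<Rightarrow> nat
      \<Rightarrow> (complex^'n \<Rightarrow> complex) set" where
  "invariant_polys K \<rho> d = {f \<in> homogeneous_polys d. \<forall>g\<in>carrier K. \<forall>z. f (\<rho> g *v z) = f z}"

definition invariant_degrees ::
    "('g, 'e::euclidean_space) lie_struct \<Rightarrow> ('g \<Rightarrow> complex^'n^'n) \<Rightarrow> nat set" where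
  "invariant_degrees K \<rho> = {d. d > 0 \<and> invariant_polys K \<rho> d \<noteq> {\<lambda>_. 0}}"

text \<open>Meaningful only if \<^term>\<open>invariant_degrees K \<rho>\<close> is nonempty.\<close>

definition d1 :: "('g, 'e::euclidean_space) lie_struct \<Rightarrow> ('g \<Rightarrow> complex^'n^'n) \<Rightarrow> nat" where
  "d1 K \<rho> = (LEAST d. d \<in> invariant_degrees K \<rho>)"


section \<open>Partial convex hulls\<close>

definition partial_convex_hull :: "nat \<Rightarrow> 'e::real_vector set \<Rightarrow> 'e set" where
  "partial_convex_hull r X = (\<Union>x \<in> {x. \<forall>j<r. x j \<in> X}. convex hull (x ` {..<r}))"

definition r0 :: "('g, 'e::euclidean_space) lie_struct \<Rightarrow> 'e \<Rightarrow> nat" where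
  "r0 K l = (LEAST r. r > 0 \<and> 0 \<in> partial_convex_hull r (adjoint_orbit K l))"

end

theory Submission
  imports Defs
begin

text \<open>Put \<open>\<mu> = q\<lambda>\<close>, let \<open>v\<close> be a highest weight vector and \<open>f\<close> a nonzero invariant of degree
  \<open>d = d\<^sub>1(\<mu>)\<close>.  Scaling by \<open>q\<close> reduces the claim to finding \<open>k\<^sub>1, \<dots>, k\<^sub>d\<close> in \<open>K\<close> such that
  \<open>Ad k\<^sub>1 \<mu> + \<dots> + Ad k\<^sub>d \<mu> = 0\<close>, for then \<open>0\<close> is the mean of \<open>d\<close> points of the orbit of \<open>\<lambda>\<close>.

  The polarization \<open>F\<close> of \<open>f\<close> is a nonzero invariant \<open>d\<close>-linear form
  (\<open>polarization_homogeneous\<close>, \<open>polarization_invariant\<close>).  In geometric terms \<open>F\<close> is an invariant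
  section of a line bundle on the \<open>d\<close>-fold power of the closed orbit in the projective space, the
  moment map of that power is the sum of the moment maps of the factors, and a nonvanishing invariant
  section forces a zero of the moment map.  Here the Kempf-Ness argument, which minimises a norm on
  an orbit of the complexified group, takes a simpler dual form: as the power of the \<open>K\<close>-orbit of
  \<open>v\<close> is compact, there is a point \<open>(\<rho>(k\<^sub>1) v, \<dots>, \<rho>(k\<^sub>d) v)\<close> at which \<open>|F|\<close> is maximal, and the first order conditions there,
  combined with the infinitesimal invariance of \<open>F\<close>, say exactly that the sum of the \<open>Ad k\<^sub>i \<mu>\<close>
  is orthogonal to every \<open>X\<close> (\<open>invariant_form_orbit_sum_zero\<close>).

  The link between multiplication by \<open>\<i>\<close> and the moment map is \<open>highest_weight_tangent\<close>: for every
  \<open>X\<close> there is \<open>Y\<close> with \<open>\<i> d\<rho>(X) v = d\<rho>(Y) v - (\<mu>|X) v\<close>.  It is immediate for \<open>X\<close> in the maximal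
  abelian subalgebra and for root vectors, so it rests on \<open>root_space_decomposition\<close>.

  The structure theory behind this is developed from the group.  Twofold differentiability of the
  multiplication gives the bracket, its invariance under \<open>Ad\<close> and the Jacobi identity.  By compactness
  \<open>Ad K\<close> is a bounded group of linear maps, so it preserves an inner product
  (\<open>bounded_group_preserves_inner_form\<close>); together with semisimplicity this makes \<open>(\<cdot>|\<cdot>)\<close> positive
  definite (\<open>kform_inner_form\<close>).  The operators \<open>ad H\<close> with \<open>H\<close> in the maximal abelian subalgebra are
  then commuting skew operators, and simultaneous diagonalization yields the root spaces.\<close>

section \<open>Inner products given by bilinear forms\<close>

text \<open>The inner products of interest on the tangent space at the identity, an \<open>Ad\<close>-invariant one and
  \<open>(\<cdot>|\<cdot>)\<close>, differ from the one that its Euclidean structure provides, so they are carried as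
  bilinear forms.\<close>

locale inner_form =
  fixes B :: "'e::euclidean_space \<Rightarrow> 'e \<Rightarrow> real"
  assumes bilin: "bilinear B"
    and sym: "B x y = B y x"
    and pos: "x \<noteq> 0 \<Longrightarrow> B x x > 0"
begin

lemma lin_left: "linear (\<lambda>x. B x y)" and lin_right: "linear (B x)"
  using bilin unfolding bilinear_def by auto

lemmas B_simps = linear_add[OF lin_left] linear_add[OF lin_right]
  linear_diff[OF lin_left] linear_diff[OF lin_right]
  linear_scale[OF lin_left] linear_scale[OF lin_right]
  linear_0[OF lin_left] linear_0[OF lin_right]
  linear_sum[OF lin_left] linear_sum[OF lin_right]
  linear_neg[OF lin_left] linear_neg[OF lin_right]

lemma eq_0_iff: "B x x = 0 \<longleftrightarrow> x = 0"
  using pos[of x] B_simps by force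

lemma nonneg: "B x x \<ge> 0"
  using pos[of x] B_simps by (cases "x = 0") auto

definition orthonormal :: "'e set \<Rightarrow> bool" where
  "orthonormal U \<longleftrightarrow> finite U \<and> (\<forall>u\<in>U. \<forall>w\<in>U. B u w = (if u = w then 1 else 0))"

lemma orthonormal_coordinate:
  assumes "orthonormal U" "w \<in> U"
  shows "B (\<Sum>u\<in>U. a u *\<^sub>R u) w = a w"
proof -
  have "B (\<Sum>u\<in>U. a u *\<^sub>R u) w = (\<Sum>u\<in>U. a u * B u w)"
    by (simp add: B_simps)
  also have "\<dots> = (\<Sum>u\<in>U. if u = w then a u else 0)"
    using assms by (intro sum.cong) (auto simp: orthonormal_def)
  also have "\<dots> = a w"
    using assms by (simp add: orthonormal_def)
  finally show ?thesis .
qed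

lemma orthonormal_independent:
  assumes "orthonormal U"
  shows "independent U"
proof -
  have "a w = 0" if "(\<Sum>u\<in>U. a u *\<^sub>R u) = 0" "w \<in> U" for a w
    using orthonormal_coordinate[OF assms that(2), of a] that(1) by (simp add: B_simps)
  then show ?thesis
    using assms by (auto simp: orthonormal_def dependent_finite)
qed

text \<open>An orthonormal subset of maximal cardinality spans, because the normalised residue of a
  vector outside the span would enlarge it.\<close>

lemma orthonormal_basis_exists:
  assumes "subspace S"
  obtains U where "orthonormal U" "span U = S"
proof -
  have bound: "card U < Suc DIM('e)" if "orthonormal U \<and> U \<subseteq> S" for U
    using independent_card_le[OF orthonormal_independent[of U]] that by simp
  have "orthonormal {} \<and> {} \<subseteq> S" by (simp add: orthonormal_def)
  then obtain U where U: "orthonormal U" "U \<subseteq> S"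
    and mx: "\<And>U'. orthonormal U' \<and> U' \<subseteq> S \<Longrightarrow> card U' \<le> card U"
    using ex_has_greatest_nat[of "\<lambda>U. orthonormal U \<and> U \<subseteq> S" "{}" card "Suc DIM('e)"]
      bound by blast
  have "x \<in> span U" if "x \<in> S" for x
  proof (rule ccontr)
    assume x: "x \<notin> span U"
    define p where "p = (\<Sum>u\<in>U. B x u *\<^sub>R u)"
    define y where "y = x - p"
    have p: "p \<in> span U" unfolding p_def by (intro span_sum span_scale span_base)
    then have "y \<noteq> 0" using x by (auto simp: y_def)
    define z where "z = (1 / sqrt (B y y)) *\<^sub>R y"
    have By: "B y y > 0" using pos \<open>y \<noteq> 0\<close> by simp
    have zz: "B z z = 1" using By by (simp add: z_def B_simps)
    have "B y u = 0" if "u \<in> U" for u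
      using orthonormal_coordinate[OF U(1) that, of "B x"] by (simp add: y_def p_def[symmetric] B_simps)
    then have zu: "B z u = 0" "B u z = 0" if "u \<in> U" for u
      using that by (simp_all add: z_def B_simps sym[of u])
    have "p \<in> S" using p span_minimal[OF U(2) assms] by auto
    then have "z \<in> S"
      using assms that by (simp add: z_def y_def subspace_diff subspace_scale)
    moreover have "z \<notin> U" using zu zz by force
    moreover have "orthonormal (insert z U)"
      using U(1) zu zz by (auto simp: orthonormal_def)
    ultimately have "card (insert z U) \<le> card U" using mx U(2) by simp
    then show False using \<open>z \<notin> U\<close> U(1) by (simp add: orthonormal_def)
  qed
  moreover have "span U \<subseteq> S" using span_minimal[OF U(2) assms] .
  ultimately show ?thesis using that U(1) by blast
qed

lemma orthonormal_expansion:
  assumes "orthonormal U" "x \<in> span U"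
  shows "x = (\<Sum>u\<in>U. B x u *\<^sub>R u)"
proof -
  obtain a where a: "x = (\<Sum>u\<in>U. a u *\<^sub>R u)"
    using assms by (auto simp: span_finite orthonormal_def)
  then have "B x u = a u" if "u \<in> U" for u
    using orthonormal_coordinate[OF assms(1) that] by simp
  then show ?thesis using a by simp
qed

text \<open>The trace is defined through the standard basis; this makes it available for a basis adapted
  to \<open>B\<close>.\<close>

lemma endo_trace_orthonormal:
  assumes U: "orthonormal U" "span U = UNIV" and f: "linear f"
  shows "endo_trace f = (\<Sum>u\<in>U. B (f u) u)"
proof -
  have "endo_trace f = (\<Sum>b\<in>Basis. \<Sum>u\<in>U. B (f b) u * (u \<bullet> b))"
  proof -
    have "f b \<bullet> b = (\<Sum>u\<in>U. B (f b) u * (u \<bullet> b))" for b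
      by (subst orthonormal_expansion[OF U(1), of "f b"]) (simp_all add: U(2) inner_sum_left)
    then show ?thesis by (simp add: endo_trace_def)
  qed
  also have "\<dots> = (\<Sum>u\<in>U. \<Sum>b\<in>Basis. B (f b) u * (u \<bullet> b))"
    by (rule sum.swap)
  also have "\<dots> = (\<Sum>u\<in>U. B (f u) u)"
  proof (rule sum.cong[OF refl])
    fix u
    have "B (f u) u = B (f (\<Sum>b\<in>Basis. (u \<bullet> b) *\<^sub>R b)) u"
      by (simp add: euclidean_representation)
    then show "(\<Sum>b\<in>Basis. B (f b) u * (u \<bullet> b)) = B (f u) u"
      by (simp add: linear_sum[OF f] linear_scale[OF f] B_simps mult.commute)
  qed
  finally show ?thesis .
qed

lemma riesz_representation:
  assumes "subspace S" "linear a"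
  obtains \<alpha> where "\<alpha> \<in> S" "\<And>H. H \<in> S \<Longrightarrow> a H = B \<alpha> H"
proof -
  obtain U where U: "orthonormal U" "span U = S"
    using orthonormal_basis_exists[OF assms(1)] .
  define \<alpha> where "\<alpha> = (\<Sum>u\<in>U. a u *\<^sub>R u)"
  have "\<alpha> \<in> span U" unfolding \<alpha>_def by (intro span_sum span_scale span_base)
  moreover have "a H = B \<alpha> H" if "H \<in> S" for H
  proof -
    have H: "H = (\<Sum>u\<in>U. B H u *\<^sub>R u)" using orthonormal_expansion U that by blast
    have "a H = (\<Sum>u\<in>U. B H u * a u)"
      by (subst H) (simp add: linear_sum[OF assms(2)] linear_scale[OF assms(2)])
    then show ?thesis by (simp add: \<alpha>_def B_simps sym[of H] mult.commute)
  qed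
  ultimately show ?thesis using that U by blast
qed

definition orth_complement :: "'e set \<Rightarrow> 'e set" where
  "orth_complement S = {x. \<forall>s\<in>S. B s x = 0}"

lemma subspace_orth_complement: "subspace (orth_complement S)"
  by (auto simp: orth_complement_def subspace_def B_simps)

lemma orth_complement_trivial:
  assumes "subspace S" "orth_complement S = {0}"
  shows "S = UNIV"
proof -
  obtain U where U: "orthonormal U" "span U = S"
    using orthonormal_basis_exists[OF assms(1)] .
  have "x \<in> S" for x
  proof -
    define p where "p = (\<Sum>u\<in>U. B x u *\<^sub>R u)"
    have p: "p \<in> S" unfolding p_def U(2)[symmetric] by (intro span_sum span_scale span_base)
    have "B u (x - p) = 0" if "u \<in> U" for u
      using orthonormal_coordinate[OF U(1) that, of "B x"]
      by (simp add: p_def[symmetric] B_simps sym[of u])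
    then have "B s (x - p) = 0" if "s \<in> S" for s
      by (subst orthonormal_expansion[OF U(1), of s])
        (simp_all add: that U(2) linear_sum[OF lin_left] linear_scale[OF lin_left])
    then have "x - p \<in> orth_complement S" by (simp add: orth_complement_def)
    then show ?thesis using p assms(2) by simp
  qed
  then show ?thesis by auto
qed

text \<open>The maximiser of the Rayleigh quotient is an eigenvector: the form
  \<open>c B(x, y) - B(A x, y)\<close> is then positive semidefinite and vanishes at \<open>(x\<^sub>0, x\<^sub>0)\<close>, so that
  \<open>x\<^sub>0\<close> lies in its radical.\<close>

lemma symmetric_eigenvector:
  assumes S: "subspace S" "S \<noteq> {0}" and A: "linear A" "\<And>x. x \<in> S \<Longrightarrow> A x \<in> S"
    and symA: "\<And>x y. x \<in> S \<Longrightarrow> y \<in> S \<Longrightarrow> B (A x) y = B x (A y)"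
  obtains c x where "x \<in> S" "x \<noteq> 0" "A x = c *\<^sub>R x"
proof -
  let ?K = "S \<inter> sphere 0 1"
  have cont: "continuous_on X (\<lambda>x. B x (L x))" if "linear L" for L X
  proof -
    have "bounded_bilinear B" using bilin by (simp add: bilinear_conv_bounded_bilinear)
    moreover have "continuous_on X L"
      using that by (simp add: linear_continuous_on linear_conv_bounded_linear)
    ultimately show ?thesis
      by (rule bounded_bilinear.continuous_on[OF _ continuous_on_id])
  qed
  have "compact ?K" using S(1) closed_subspace by (intro closed_Int_compact) auto
  moreover obtain z where "z \<in> S" "z \<noteq> 0" using S subspace_0 by blast
  then have "(1 / norm z) *\<^sub>R z \<in> ?K" using S(1) by (auto simp: subspace_scale)
  then have "?K \<noteq> {}" by blast
  moreover have nz: "B x x \<noteq> 0" if "x \<in> ?K" for x using that eq_0_iff[of x] by auto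
  have "continuous_on ?K (\<lambda>x. B x (A x) / B x x)"
    using cont[OF A(1)] cont[OF linear_id] nz by (intro continuous_on_divide) auto
  ultimately obtain x where x: "x \<in> ?K"
    and mx: "\<And>y. y \<in> ?K \<Longrightarrow> B y (A y) / B y y \<le> B x (A x) / B x x"
    using continuous_attains_sup[of ?K "\<lambda>x. B x (A x) / B x x"] by blast
  define c where "c = B x (A x) / B x x"
  define G where "G u w = c * B u w - B u (A w)" for u w
  have G_nonneg: "G y y \<ge> 0" if "y \<in> S" for y
  proof (cases "y = 0")
    case False
    let ?y = "(1 / norm y) *\<^sub>R y"
    have "?y \<in> ?K" using that False S(1) by (auto simp: subspace_scale)
    from mx[OF this] have "B y (A y) / B y y \<le> c"
      using False by (simp add: linear_scale[OF A(1)] B_simps c_def)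
    then show ?thesis using pos[OF False] by (simp add: G_def field_simps)
  qed (simp add: G_def linear_0[OF A(1)] B_simps)
  have Gx: "G x x = 0" using nz[OF x] by (simp add: G_def c_def)
  have xS: "x \<in> S" using x by simp
  have "G x y = 0" if y: "y \<in> S" for y
  proof -
    have sy: "G y x = G x y"
      using symA[OF xS y] by (simp add: G_def sym[of y])
    have exp: "G (x + s *\<^sub>R y) (x + s *\<^sub>R y) = 2 * s * G x y + s\<^sup>2 * G y y" for s
    proof -
      have "G (x + s *\<^sub>R y) (x + s *\<^sub>R y) = G x x + s * G x y + s * G y x + s * (s * G y y)"
        by (simp add: G_def B_simps linear_add[OF A(1)] linear_scale[OF A(1)] algebra_simps)
      then show ?thesis using sy Gx by (simp add: power2_eq_square)
    qed
    have ineq: "2 * s * G x y + s\<^sup>2 * G y y \<ge> 0" for s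
      using G_nonneg[of "x + s *\<^sub>R y"] exp[of s] S(1) xS y by (simp add: subspace_add subspace_scale)
    show ?thesis
    proof (rule ccontr)
      assume ne: "G x y \<noteq> 0"
      \<comment> \<open>The polynomial of \<open>ineq\<close> is negative at \<open>s = - g / h\<close>; the summand \<open>1\<close> in \<open>h\<close> covers
        the case of a zero leading coefficient.\<close>
      define g where "g = G x y"
      define h where "h = G y y + 1"
      have h: "h > 0" using G_nonneg[OF y] by (simp add: h_def)
      have "2 * (- g / h) * g + (- g / h)\<^sup>2 * (h - 1) \<ge> 0"
        using ineq[of "- g / h"] by (simp add: g_def h_def)
      moreover have "2 * (- g / h) * g + (- g / h)\<^sup>2 * (h - 1) = g\<^sup>2 * (- 2 * h + (h - 1)) / h\<^sup>2"
        using h by (simp add: field_simps power2_eq_square)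
      moreover have "g\<^sup>2 * (- 2 * h + (h - 1)) / h\<^sup>2 < 0"
        using h ne by (intro divide_neg_pos mult_pos_neg) (auto simp: g_def)
      ultimately show False by simp
    qed
  qed
  moreover have "B x (A y) = B (A x) y" if "y \<in> S" for y using symA[OF xS that] by simp
  ultimately have "B (c *\<^sub>R x - A x) y = 0" if "y \<in> S" for y
    using that by (simp add: G_def B_simps)
  moreover have "c *\<^sub>R x - A x \<in> S" using S(1) xS A(2) by (simp add: subspace_diff subspace_scale)
  ultimately have "c *\<^sub>R x - A x = 0" using eq_0_iff by blast
  then show ?thesis using that xS x by (metis IntD2 eq_iff_diff_eq_0 mem_sphere_0 norm_zero zero_neq_one)
qed

end

section \<open>Bounded groups of linear maps preserve an inner product\<close>

text \<open>Kakutani's fixed point argument.  The group acts on the forms \<open>(x, y) \<mapsto> S x \<bullet> y\<close> by pulling back along its elements, and it preserves the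
  compact convex set \<open>C\<close> of symmetric forms that are uniformly bounded and uniformly positive
  along the group.  The function sending a form to the supremum over \<open>g\<close> of the squared
  Hilbert-Schmidt norms \<open>Q g\<close> of its translates is invariant and strictly convex: by the parallelogram law, the
  midpoint of two distinct minimisers would have a smaller value.  Hence the minimiser is unique,
  and so it is fixed by the group.\<close>

lemma bounded_group_preserves_inner_form:
  fixes G :: "('e::euclidean_space \<Rightarrow> 'e) set"
  assumes lin: "\<And>g. g \<in> G \<Longrightarrow> linear g"
    and comp: "\<And>g h. g \<in> G \<Longrightarrow> h \<in> G \<Longrightarrow> g \<circ> h \<in> G"
    and idG: "id \<in> G"
    and inverse: "\<And>g. g \<in> G \<Longrightarrow> \<exists>h\<in>G. g \<circ> h = id"
    and bound: "\<And>g x. g \<in> G \<Longrightarrow> norm (g x) \<le> M * norm x"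
  obtains B where "inner_form B" "\<And>g x y. g \<in> G \<Longrightarrow> B (g x) (g y) = B x y"
proof -
  obtain b0 :: 'e where "b0 \<in> Basis" using nonempty_Basis by blast
  then have M1: "M \<ge> 1" using bound[OF idG, of b0] by simp
  define C where "C = (\<Inter>x y. {S :: 'e \<Rightarrow>\<^sub>L 'e. S x \<bullet> y = x \<bullet> S y})
    \<inter> (\<Inter>g\<in>G. \<Inter>x y. {S :: 'e \<Rightarrow>\<^sub>L 'e. \<bar>S (g x) \<bullet> g y\<bar> \<le> M\<^sup>2 * (norm x * norm y)})
    \<inter> (\<Inter>g\<in>G. \<Inter>x. {S :: 'e \<Rightarrow>\<^sub>L 'e. (norm x)\<^sup>2 \<le> M\<^sup>2 * (S (g x) \<bullet> g x)})"
  define Q where "Q g S = (\<Sum>p\<in>Basis \<times> Basis. (S (g (fst p)) \<bullet> g (snd p))\<^sup>2)"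
    for g :: "'e \<Rightarrow> 'e" and S :: "'e \<Rightarrow>\<^sub>L 'e"
  \<comment> \<open>A sublevel set of the supremum of the functions \<open>Q g\<close>, compact as an intersection of
    closed subsets of \<open>C\<close>; the intersection of the nonempty ones consists of the minimisers.\<close>
  define L where "L r = C \<inter> (\<Inter>g\<in>G. {S. Q g S \<le> r})" for r
  have in_C: "S \<in> C \<longleftrightarrow> (\<forall>x y. S x \<bullet> y = x \<bullet> S y) \<and>
      (\<forall>g\<in>G. \<forall>x y. \<bar>S (g x) \<bullet> g y\<bar> \<le> M\<^sup>2 * (norm x * norm y)) \<and>
      (\<forall>g\<in>G. \<forall>x. (norm x)\<^sup>2 \<le> M\<^sup>2 * (S (g x) \<bullet> g x))" for S
    unfolding C_def by auto
  have in_L: "S \<in> L r \<longleftrightarrow> S \<in> C \<and> (\<forall>g\<in>G. Q g S \<le> r)" for S r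
    unfolding L_def by auto
  have closed_C: "closed C"
    unfolding C_def
    by (intro closed_Int closed_INT ballI closed_Collect_eq closed_Collect_le continuous_intros)
  have "norm S \<le> M\<^sup>2" if S: "S \<in> C" for S
  proof (rule norm_blinfun_bound)
    fix x
    have "\<bar>S (id x) \<bullet> id (S x)\<bar> \<le> M\<^sup>2 * (norm x * norm (S x))"
      using S idG unfolding in_C by blast
    then have "norm (S x) * norm (S x) \<le> M\<^sup>2 * (norm x * norm (S x))"
      by (simp add: power2_norm_eq_inner[symmetric] power2_eq_square)
    then have "norm (S x) * norm (S x) \<le> (M\<^sup>2 * norm x) * norm (S x)"
      by (simp add: mult.assoc)
    then show "norm (S x) \<le> M\<^sup>2 * norm x"
      by (cases "S x = 0") auto
  qed simp
  then have compact_C: "compact C"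
    using closed_C by (auto simp: compact_eq_bounded_closed bounded_iff)
  have closed_L: "closed (L r)" for r
    unfolding L_def Q_def
    by (intro closed_Int closed_C closed_INT ballI closed_Collect_le continuous_intros)
  have compact_L: "compact (L r)" for r
    using compact_Int_closed[OF compact_C closed_L, of r] by (simp add: L_def Int_assoc inf.absorb2)
  have Q_nonneg: "Q g S \<ge> 0" for g S unfolding Q_def by (intro sum_nonneg) auto

  have id_C: "id_blinfun \<in> C"
    unfolding in_C
  proof (intro conjI allI ballI)
    fix g x y assume g: "g \<in> G"
    have "\<bar>g x \<bullet> g y\<bar> \<le> norm (g x) * norm (g y)" by (rule Cauchy_Schwarz_ineq2)
    also have "\<dots> \<le> (M * norm x) * (M * norm y)"
      using bound[OF g] M1 by (intro mult_mono) auto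
    finally show "\<bar>id_blinfun (g x) \<bullet> g y\<bar> \<le> M\<^sup>2 * (norm x * norm y)"
      by (simp add: power2_eq_square mult_ac)
  next
    fix g x assume g: "g \<in> G"
    obtain h where h: "h \<in> G" "g \<circ> h = id" using inverse[OF g] by blast
    obtain k where k: "k \<in> G" "h \<circ> k = id" using inverse[OF h(1)] by blast
    have "h \<circ> g = id" using h(2) k(2) by (metis comp_assoc comp_id id_comp)
    then have "norm x \<le> M * norm (g x)" using bound[OF h(1), of "g x"] by (simp add: fun_eq_iff)
    then have "(norm x)\<^sup>2 \<le> (M * norm (g x))\<^sup>2" by (intro power_mono) auto
    then show "(norm x)\<^sup>2 \<le> M\<^sup>2 * (id_blinfun (g x) \<bullet> g x)"
      by (simp add: power_mult_distrib power2_norm_eq_inner)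
  qed auto

  define V where "V = {r. L r \<noteq> {}}"
  define m where "m = Inf V"
  have "Q g id_blinfun \<le> (\<Sum>p\<in>(Basis \<times> Basis :: ('e \<times> 'e) set). (M\<^sup>2)\<^sup>2)" if g: "g \<in> G" for g
    unfolding Q_def
  proof (intro sum_mono)
    fix p :: "'e \<times> 'e" assume p: "p \<in> Basis \<times> Basis"
    have "\<bar>id_blinfun (g (fst p)) \<bullet> g (snd p)\<bar> \<le> M\<^sup>2 * (norm (fst p) * norm (snd p))"
      using id_C g unfolding in_C by blast
    also have "\<dots> = M\<^sup>2" using p by (simp add: mem_Times_iff)
    finally show "(id_blinfun (g (fst p)) \<bullet> g (snd p))\<^sup>2 \<le> (M\<^sup>2)\<^sup>2"
      by (metis abs_ge_zero power2_abs power_mono)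
  qed
  then have "id_blinfun \<in> L (\<Sum>p\<in>(Basis \<times> Basis :: ('e \<times> 'e) set). (M\<^sup>2)\<^sup>2)"
    using id_C unfolding in_L by blast
  then have "V \<noteq> {}" unfolding V_def by blast
  have below: "0 \<le> r" if "r \<in> V" for r
  proof -
    obtain S where "S \<in> L r" using \<open>r \<in> V\<close> unfolding V_def by blast
    then have "Q id S \<le> r" using idG by (simp add: in_L)
    then show ?thesis using Q_nonneg[of id S] by linarith
  qed
  then have bdd: "bdd_below V" by (auto simp: bdd_below_def)
  have L_mono: "L r \<subseteq> L r'" if "r \<le> r'" for r r'
    using that by (meson in_L order_trans subsetI)
  have "L (m + 1 / real (Suc n)) \<noteq> {}" for n
  proof -
    obtain r where "r \<in> V" "r < m + 1 / real (Suc n)"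
      using cInf_lessD[OF \<open>V \<noteq> {}\<close>, of "m + 1 / real (Suc n)"] by (auto simp: m_def)
    then show ?thesis using L_mono[of r "m + 1 / real (Suc n)"] by (auto simp: V_def)
  qed
  moreover have "L (m + 1 / real (Suc n')) \<subseteq> L (m + 1 / real (Suc n))" if "n \<le> n'" for n n'
    using that by (intro L_mono) (simp add: frac_le)
  ultimately have "\<Inter> (range (\<lambda>n. L (m + 1 / real (Suc n)))) \<noteq> {}"
    by (intro compact_nest compact_L) auto
  then obtain S where S: "\<And>n. S \<in> L (m + 1 / real (Suc n))" by auto
  have SL: "S \<in> L m"
    unfolding in_L
  proof (intro conjI ballI)
    show "S \<in> C" using S in_L by blast
    fix g assume g: "g \<in> G"
    show "Q g S \<le> m"
    proof (rule field_le_epsilon)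
      fix e :: real assume "e > 0"
      then obtain n where "1 / real (Suc n) < e" using nat_approx_posE by blast
      moreover have "Q g S \<le> m + 1 / real (Suc n)" using S[of n] g by (simp add: in_L)
      ultimately show "Q g S \<le> m + e" by linarith
    qed
  qed

  have inv: "S (k x) \<bullet> k y = S x \<bullet> y" if k: "k \<in> G" for k x y
  proof (rule ccontr)
    assume neq: "S (k x) \<bullet> k y \<noteq> S x \<bullet> y"
    \<comment> \<open>The pullback of \<open>S\<close> along \<open>k\<close> is a second minimiser.\<close>
    define S' where "S' = Blinfun (adjoint k \<circ> S \<circ> k)"
    have "linear (adjoint k \<circ> S \<circ> k)"
      by (intro linear_compose lin k adjoint_linear bounded_linear.linear[OF blinfun.bounded_linear_right])
    then have ap: "S' z = adjoint k (S (k z))" for z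
      by (simp add: S'_def bounded_linear_Blinfun_apply linear_conv_bounded_linear)
    have S': "S' z \<bullet> w = S (k z) \<bullet> k w" for z w
      using adjoint_works[OF lin[OF k], of w "S (k z)"] by (simp add: ap inner_commute)
    have kg: "k \<circ> g \<in> G" if "g \<in> G" for g using comp k that by blast
    have S'L: "S' \<in> L m"
      unfolding in_L in_C
    proof (intro conjI ballI allI)
      fix z w
      show "S' z \<bullet> w = z \<bullet> S' w"
        using SL by (simp add: S' in_L in_C inner_commute[of z])
          (metis inner_commute)
    next
      fix g z w assume "g \<in> G"
      then show "\<bar>S' (g z) \<bullet> g w\<bar> \<le> M\<^sup>2 * (norm z * norm w)"
        using SL[unfolded in_L in_C] kg[of g] by (auto simp: S')
    next
      fix g z assume "g \<in> G"
      then show "(norm z)\<^sup>2 \<le> M\<^sup>2 * (S' (g z) \<bullet> g z)"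
        using SL[unfolded in_L in_C] kg[of g] by (auto simp: S')
    next
      fix g assume "g \<in> G"
      then show "Q g S' \<le> m"
        using SL[unfolded in_L] kg[of g] by (auto simp: S' Q_def)
    qed
    define T where "T = (1/2) *\<^sub>R (S + S')"
    define D where "D = S - S'"
    have T: "T z \<bullet> w = (S z \<bullet> w + S' z \<bullet> w) / 2" for z w
      by (simp add: T_def blinfun.scaleR_left blinfun.add_left inner_add_left)
    have D: "D z \<bullet> w = S z \<bullet> w - S' z \<bullet> w" for z w
      by (simp add: D_def blinfun.diff_left inner_diff_left)
    have "T \<in> C"
      unfolding in_C
    proof (intro conjI ballI allI)
      fix z w
      have "S z \<bullet> w = z \<bullet> S w" "S' z \<bullet> w = z \<bullet> S' w" using SL S'L by (auto simp: in_L in_C)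
      then show "T z \<bullet> w = z \<bullet> T w"
        by (simp add: T_def blinfun.scaleR_left blinfun.add_left inner_add_left inner_add_right)
    next
      fix g z w assume "g \<in> G"
      then have "\<bar>S (g z) \<bullet> g w\<bar> \<le> M\<^sup>2 * (norm z * norm w)" "\<bar>S' (g z) \<bullet> g w\<bar> \<le> M\<^sup>2 * (norm z * norm w)"
        using SL S'L by (auto simp: in_L in_C)
      moreover have "\<bar>(a + b) / 2\<bar> \<le> r" if "\<bar>a\<bar> \<le> r" "\<bar>b\<bar> \<le> r" for a b r :: real
        using that by (auto simp: abs_le_iff)
      ultimately show "\<bar>T (g z) \<bullet> g w\<bar> \<le> M\<^sup>2 * (norm z * norm w)" unfolding T by blast
    next
      fix g z assume "g \<in> G"
      then have "(norm z)\<^sup>2 \<le> M\<^sup>2 * (S (g z) \<bullet> g z)" "(norm z)\<^sup>2 \<le> M\<^sup>2 * (S' (g z) \<bullet> g z)"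
        using SL S'L by (auto simp: in_L in_C)
      then show "(norm z)\<^sup>2 \<le> M\<^sup>2 * (T (g z) \<bullet> g z)" unfolding T by (simp add: field_simps)
    qed
    \<comment> \<open>The deficit in the parallelogram law must be bounded below uniformly in \<open>g\<close>.  This holds
      because \<open>D x \<bullet> y\<close> can be recovered from the translate of \<open>D\<close> by \<open>g\<close> through the bounded
      inverse of \<open>g\<close>.\<close>
    define \<delta> where "\<delta> = (D x \<bullet> y)\<^sup>2 / (M\<^sup>2 * norm x * norm y)\<^sup>2"
    have nz: "D x \<bullet> y \<noteq> 0" using neq by (simp add: D S')
    then have xy: "x \<noteq> 0" "y \<noteq> 0" by (auto simp: blinfun.zero_right)
    have "\<delta> > 0" using nz xy M1 by (auto simp: \<delta>_def)
    have Q_lower: "\<delta> \<le> Q g D" if g: "g \<in> G" for g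
    proof -
      obtain h where h: "h \<in> G" "g \<circ> h = id" using inverse[OF g] by blast
      have gh: "g (h z) = z" for z using h(2) by (simp add: fun_eq_iff)
      have exp: "g (h z) = (\<Sum>b\<in>Basis. (h z \<bullet> b) *\<^sub>R g b)" for z
        using linear_sum[OF lin[OF g], of "\<lambda>b. (h z \<bullet> b) *\<^sub>R b" Basis]
        by (simp add: euclidean_representation linear_scale[OF lin[OF g]])
      have "D x \<bullet> y = D (g (h x)) \<bullet> g (h y)" by (simp add: gh)
      also have "\<dots> = (\<Sum>b\<in>Basis. \<Sum>c\<in>Basis. ((h x \<bullet> b) * (h y \<bullet> c)) * (D (g b) \<bullet> g c))"
        unfolding exp[of x] exp[of y]
        by (simp add: blinfun.sum_right blinfun.scaleR_right inner_sum_left inner_sum_right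
            sum_distrib_left mult_ac) (rule sum.swap)
      also have "\<dots> = (\<Sum>p\<in>Basis\<times>Basis. ((h x \<bullet> fst p) * (h y \<bullet> snd p)) * (D (g (fst p)) \<bullet> g (snd p)))"
        by (simp add: sum.cartesian_product case_prod_beta)
      finally have Dxy: "D x \<bullet> y = \<dots>" .
      have "(D x \<bullet> y)\<^sup>2 \<le> (\<Sum>p\<in>Basis\<times>Basis. ((h x \<bullet> fst p) * (h y \<bullet> snd p))\<^sup>2) * Q g D"
        unfolding Q_def Dxy by (rule Cauchy_Schwarz_ineq_sum)
      also have "(\<Sum>p\<in>Basis\<times>Basis. ((h x \<bullet> fst p) * (h y \<bullet> snd p))\<^sup>2)
          = (\<Sum>b\<in>Basis. (h x \<bullet> b)\<^sup>2) * (\<Sum>c\<in>Basis. (h y \<bullet> c)\<^sup>2)"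
        by (simp add: sum_product sum.cartesian_product case_prod_beta power_mult_distrib)
      also have "\<dots> = (norm (h x))\<^sup>2 * (norm (h y))\<^sup>2"
        unfolding power2_norm_eq_inner
        by (simp add: euclidean_inner[of "h x" "h x"] euclidean_inner[of "h y" "h y"] power2_eq_square)
      also have "\<dots> * Q g D \<le> (M\<^sup>2 * norm x * norm y)\<^sup>2 * Q g D"
      proof (rule mult_right_mono[OF _ Q_nonneg])
        have "(norm (h x))\<^sup>2 * (norm (h y))\<^sup>2 \<le> (M * norm x)\<^sup>2 * (M * norm y)\<^sup>2"
          using bound[OF h(1)] by (intro mult_mono power_mono) auto
        then show "(norm (h x))\<^sup>2 * (norm (h y))\<^sup>2 \<le> (M\<^sup>2 * norm x * norm y)\<^sup>2"
          by (simp add: power2_eq_square mult_ac)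
      qed
      finally show ?thesis using xy M1 by (simp add: \<delta>_def divide_le_eq mult.commute)
    qed
    have "Q g T \<le> m - \<delta> / 4" if g: "g \<in> G" for g
    proof -
      have "4 * Q g T + Q g D = 2 * Q g S + 2 * Q g S'"
        unfolding Q_def T D sum_distrib_left sum.distrib[symmetric]
        by (intro sum.cong refl) (simp add: power2_eq_square field_simps)
      moreover have "Q g S \<le> m" "Q g S' \<le> m" using SL S'L g by (auto simp: in_L)
      ultimately show ?thesis using Q_lower[OF g] by linarith
    qed
    then have "T \<in> L (m - \<delta> / 4)" using \<open>T \<in> C\<close> by (simp add: in_L)
    then have "m - \<delta> / 4 \<in> V" by (auto simp: V_def)
    then have "m \<le> m - \<delta> / 4" unfolding m_def using bdd by (rule cInf_lower)
    then show False using \<open>\<delta> > 0\<close> by simp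
  qed
  have S_C: "S \<in> C" using SL by (simp add: in_L)
  have "inner_form (\<lambda>x y. S x \<bullet> y)"
  proof
    show "bilinear (\<lambda>x y. S x \<bullet> y)"
      unfolding bilinear_def
      by (auto intro!: linearI simp: blinfun.add_right blinfun.scaleR_right inner_add_left inner_add_right)
    show "S x \<bullet> y = S y \<bullet> x" for x y using S_C by (simp add: in_C inner_commute[of x])
    show "S x \<bullet> x > 0" if "x \<noteq> 0" for x
    proof -
      have "(norm x)\<^sup>2 \<le> M\<^sup>2 * (S (id x) \<bullet> id x)" using S_C idG unfolding in_C by blast
      moreover have "(norm x)\<^sup>2 > 0" using that by simp
      ultimately show ?thesis by (smt (verit) id_apply mult_nonneg_nonpos zero_le_power2)
    qed
  qed
  then show ?thesis using that inv by blast
qed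

section \<open>Multilinear forms and polarization\<close>

text \<open>Sums of decomposable multilinear forms, as an inductive predicate: every property needed
  below passes from monomials to sums.  A tuple of \<open>d\<close> vectors is a sequence of which only the first
  \<open>d\<close> entries count.\<close>

inductive multiform :: "nat \<Rightarrow> ((nat \<Rightarrow> complex^'n) \<Rightarrow> complex) \<Rightarrow> bool" for d where
  monomial: "multiform d (\<lambda>y. c * (\<Prod>j<d. y j $ w j))"
| add: "multiform d F \<Longrightarrow> multiform d G \<Longrightarrow> multiform d (\<lambda>y. F y + G y)"

lemma prod_fun_upd_component:
  fixes y :: "nat \<Rightarrow> complex^'n"
  assumes "i < d"
  shows "(\<Prod>j<d. (y(i := x)) j $ w j) = x $ w i * (\<Prod>j\<in>{..<d} - {i}. y j $ w j)"
  using assms by (subst prod.remove[of _ i]) auto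

lemma multiform_add_slot:
  assumes "multiform d F" "i < d"
  shows "F (y(i := x + z)) = F (y(i := x)) + F (y(i := z))"
  using assms
  by (induction rule: multiform.induct)
    (simp_all add: prod_fun_upd_component algebra_simps del: fun_upd_apply)

lemma multiform_scale_slot:
  assumes "multiform d F" "i < d"
  shows "F (y(i := a *s x)) = a * F (y(i := x))"
  using assms
  by (induction rule: multiform.induct)
    (simp_all add: prod_fun_upd_component algebra_simps del: fun_upd_apply)

lemma multiform_cong:
  assumes "multiform d F" "\<And>j. j < d \<Longrightarrow> y j = y' j"
  shows "F y = F y'"
  using assms by (induction rule: multiform.induct) (auto intro!: prod.cong)

lemma multiform_has_derivative:
  assumes "multiform d F" "\<And>j. j < d \<Longrightarrow> (Y j has_derivative Y' j) (at x)"
  shows "((\<lambda>x. F (\<lambda>j. Y j x)) has_derivative (\<lambda>h. \<Sum>i<d. F ((\<lambda>j. Y j x)(i := Y' i h)))) (at x)"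
  using assms
proof (induction rule: multiform.induct)
  case (monomial c w)
  have "((\<lambda>x. \<Prod>j<d. Y j x $ w j) has_derivative
      (\<lambda>h. \<Sum>i<d. Y' i h $ w i * (\<Prod>j\<in>{..<d} - {i}. Y j x $ w j))) (at x)"
    using monomial by (intro has_derivative_prod bounded_linear.has_derivative[OF bounded_linear_vec_nth]) auto
  then have "((\<lambda>x. c * (\<Prod>j<d. Y j x $ w j)) has_derivative
      (\<lambda>h. c * (\<Sum>i<d. Y' i h $ w i * (\<Prod>j\<in>{..<d} - {i}. Y j x $ w j)))) (at x)"
    by (rule has_derivative_mult_right)
  moreover have "(\<Sum>i<d. c * (\<Prod>j<d. ((\<lambda>j. Y j x)(i := Y' i h)) j $ w j))
      = c * (\<Sum>i<d. Y' i h $ w i * (\<Prod>j\<in>{..<d} - {i}. Y j x $ w j))" for h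
    by (simp add: prod_fun_upd_component sum_distrib_left del: fun_upd_apply)
  ultimately show ?case by presburger
next
  case (add F G)
  show ?case
    using has_derivative_add[OF add.IH] add.prems by (simp add: sum.distrib)
qed

lemma continuous_map_mult_complex:
  fixes f g :: "'a \<Rightarrow> complex"
  assumes "continuous_map X euclidean f" "continuous_map X euclidean g"
  shows "continuous_map X euclidean (\<lambda>x. f x * g x)"
proof -
  have "continuous_map X (prod_topology euclidean euclidean) (\<lambda>x. (f x, g x))"
    using assms by (simp only: continuous_map_paired)
  then have "continuous_map X euclidean (\<lambda>x. (f x, g x))"
    by (simp only: prod_topology_euclidean)
  from continuous_map_compose[OF this, of euclidean "\<lambda>p. fst p * snd p"]
  show ?thesis by (simp add: o_def continuous_intros)
qed

lemma continuous_map_prod_complex: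
  fixes f :: "'i \<Rightarrow> 'a \<Rightarrow> complex"
  assumes "\<And>i. i \<in> I \<Longrightarrow> continuous_map X euclidean (f i)"
  shows "continuous_map X euclidean (\<lambda>x. \<Prod>i\<in>I. f i x)"
  using assms
  by (induction I rule: infinite_finite_induct) (auto intro: continuous_map_mult_complex)

lemma continuous_map_multiform:
  assumes "multiform d F" "\<And>j. j < d \<Longrightarrow> continuous_map X euclidean (Y j)"
  shows "continuous_map X euclidean (\<lambda>x. F (\<lambda>j. Y j x))"
  using assms
proof (induction rule: multiform.induct)
  case (monomial c w)
  have "continuous_map X euclidean (\<lambda>x. Y j x $ w j)" if "j < d" for j
    using continuous_map_compose[OF monomial[OF that], of euclidean "\<lambda>z. z $ w j"]
    by (simp add: o_def continuous_on_component)
  then show ?case by (intro continuous_map_mult_complex continuous_map_prod_complex) auto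
qed (auto intro: continuous_map_add)

text \<open>The slots are freed one after the other, a complex linear form that vanishes on a spanning
  set being zero.\<close>

lemma multiform_eq_0_of_span:
  assumes F: "multiform d F" and span: "vec.span Z = UNIV"
    and zero: "\<And>y. (\<And>j. j < d \<Longrightarrow> y j \<in> Z) \<Longrightarrow> F y = 0"
  shows "F y = 0"
proof -
  have "F y = 0" if "k \<le> d" "\<And>j. k \<le> j \<Longrightarrow> j < d \<Longrightarrow> y j \<in> Z" for k y
    using that
  proof (induction k arbitrary: y)
    case 0
    then show ?case using zero by simp
  next
    case (Suc k)
    have "F (y(k := x)) = 0" for x
    proof -
      have "x \<in> vec.span Z" using span by simp
      then show ?thesis
      proof (induction rule: vec.span_induct_alt)
        case base
        show ?case using multiform_scale_slot[OF F, of k y 0 0] Suc.prems by (simp del: fun_upd_apply)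
      next
        case (step c z x)
        have "F (y(k := z)) = 0"
          using step Suc.prems by (intro Suc.IH) auto
        then show ?case
          using step Suc.prems by (simp add: multiform_add_slot[OF F] multiform_scale_slot[OF F] del: fun_upd_apply)
      qed
    qed
    from this[of "y k"] show ?case by simp
  qed
  from this[of d y] show ?thesis by simp
qed

text \<open>Up to the factor \<open>(-1)\<^sup>d d!\<close> this is the alternating-sum polarization formula.  Since it uses only
  the values of \<open>f\<close> and addition, invariance of \<open>f\<close> under linear maps passes to it at once.\<close>

definition polarization :: "nat \<Rightarrow> (complex^'n \<Rightarrow> complex) \<Rightarrow> (nat \<Rightarrow> complex^'n) \<Rightarrow> complex" where
  "polarization d f y = (\<Sum>S\<in>Pow {..<d}. (-1) ^ card S * f (\<Sum>j\<in>S. y j))"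

text \<open>These are the permutations of the \<open>d\<close> slots, in the form in which they arise when a product of
  sums is expanded.\<close>

definition self_surjections :: "nat \<Rightarrow> (nat \<Rightarrow> nat) set" where
  "self_surjections d = {\<sigma> \<in> PiE {..<d} (\<lambda>_. {..<d}). \<sigma> ` {..<d} = {..<d}}"

lemma finite_self_surjections: "finite (self_surjections d)"
  by (simp add: self_surjections_def finite_PiE)

lemma self_surjections_nonempty: "self_surjections d \<noteq> {}"
proof -
  have "restrict id {..<d} \<in> self_surjections d" by (auto simp: self_surjections_def)
  then show ?thesis by blast
qed

text \<open>Expanding the product gives a sum over all maps \<open>\<sigma>\<close> from slots to slots.  Each one is
  counted, with sign, once for every \<open>S\<close> that contains its range; the signs cancel unless the
  range is everything.\<close>

lemma polarization_monomial:
  fixes y :: "nat \<Rightarrow> complex^'n"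
  shows "polarization d (\<lambda>z. c * (\<Prod>i<d. z $ w i)) y =
    (\<Sum>\<sigma>\<in>self_surjections d. ((-1) ^ d * c) * (\<Prod>i<d. y (\<sigma> i) $ w i))"
proof -
  let ?D = "{..<d}"
  let ?P = "PiE ?D (\<lambda>_. ?D)"
  define m where "m \<sigma> = (\<Prod>i<d. y (\<sigma> i) $ w i)" for \<sigma>
  have fin: "finite ?P" by (simp add: finite_PiE)
  have inner: "(\<Prod>i<d. (\<Sum>j\<in>S. y j) $ w i) = (\<Sum>\<sigma>\<in>?P. if \<sigma> ` ?D \<subseteq> S then m \<sigma> else 0)" if "S \<in> Pow ?D" for S
  proof -
    have "finite S" using that finite_subset by auto
    then have "(\<Prod>i<d. (\<Sum>j\<in>S. y j) $ w i) = (\<Sum>\<sigma>\<in>PiE ?D (\<lambda>_. S). m \<sigma>)"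
      unfolding m_def sum_component by (intro prod_sum_PiE) auto
    also have "PiE ?D (\<lambda>_. S) = {\<sigma>\<in>?P. \<sigma> ` ?D \<subseteq> S}"
      using that by (auto simp: PiE_iff image_subset_iff extensional_def)
    also have "(\<Sum>\<sigma>\<in>{\<sigma>\<in>?P. \<sigma> ` ?D \<subseteq> S}. m \<sigma>) = (\<Sum>\<sigma>\<in>?P. if \<sigma> ` ?D \<subseteq> S then m \<sigma> else 0)"
      using fin by (simp add: sum.inter_filter)
    finally show ?thesis .
  qed
  have signs: "(\<Sum>S\<in>Pow ?D. if R \<subseteq> S then (-1) ^ card S else (0::complex)) = (if R = ?D then (-1) ^ d else 0)"
    if "R \<subseteq> ?D" for R
  proof -
    have "(\<Sum>S\<in>Pow ?D. if R \<subseteq> S then (-1) ^ card S else (0::complex))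
        = (\<Sum>S\<in>{S\<in>Pow ?D. R \<subseteq> S}. (-1) ^ card S)"
      by (rule sum.inter_filter[symmetric]) simp
    also have "\<dots> = (if R = ?D then (-1) ^ d else 0)"
    proof (cases "R = ?D")
      case True
      then have "{S\<in>Pow ?D. R \<subseteq> S} = {?D}" by auto
      then show ?thesis using True by simp
    next
      case False
      have "card {S \<in> {S\<in>Pow ?D. R \<subseteq> S}. even (card S)} = card {S \<in> {S\<in>Pow ?D. R \<subseteq> S}. odd (card S)}"
        using card_subsupersets_even_odd[of ?D R] False that by (simp add: psubset_eq)
      then show ?thesis
        using False by (simp add: sum_alternating_cancels)
    qed
    finally show ?thesis .
  qed
  have "polarization d (\<lambda>z. c * (\<Prod>i<d. z $ w i)) y
      = (\<Sum>S\<in>Pow ?D. \<Sum>\<sigma>\<in>?P. c * m \<sigma> * (if \<sigma> ` ?D \<subseteq> S then (-1) ^ card S else 0))"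
    unfolding polarization_def
    by (intro sum.cong refl, subst inner)
      (auto simp: sum_distrib_left mult_ac intro!: sum.cong)
  also have "\<dots> = (\<Sum>\<sigma>\<in>?P. \<Sum>S\<in>Pow ?D. c * m \<sigma> * (if \<sigma> ` ?D \<subseteq> S then (-1) ^ card S else 0))"
    by (rule sum.swap)
  also have "\<dots> = (\<Sum>\<sigma>\<in>?P. c * m \<sigma> * (if \<sigma> ` ?D = ?D then (-1) ^ d else 0))"
    by (intro sum.cong refl) (subst sum_distrib_left[symmetric], subst signs, auto)
  also have "\<dots> = (\<Sum>\<sigma>\<in>?P. if \<sigma> ` ?D = ?D then ((-1) ^ d * c) * m \<sigma> else 0)"
    by (intro sum.cong refl) (simp add: mult_ac)
  also have "\<dots> = (\<Sum>\<sigma>\<in>self_surjections d. ((-1) ^ d * c) * m \<sigma>)"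
    unfolding self_surjections_def using fin by (simp add: sum.inter_filter)
  finally show ?thesis unfolding m_def .
qed

lemma multiform_zero: "multiform d (\<lambda>_. 0)"
  using multiform.monomial[of d 0] by simp

lemma multiform_sum:
  "(\<And>a. a \<in> A \<Longrightarrow> multiform d (F a)) \<Longrightarrow> multiform d (\<lambda>y. \<Sum>a\<in>A. F a y)"
  by (induction A rule: infinite_finite_induct) (auto intro: multiform.add multiform_zero)

lemma multiform_reindexed_monomial:
  assumes "\<sigma> \<in> self_surjections d"
  shows "multiform d (\<lambda>y. c * (\<Prod>i<d. y (\<sigma> i) $ w i))"
proof -
  have "bij_betw \<sigma> {..<d} {..<d}"
    using assms by (auto simp: self_surjections_def bij_betw_def eq_card_imp_inj_on)
  then obtain \<tau> where \<tau>: "bij_betw \<tau> {..<d} {..<d}" "\<And>j. j < d \<Longrightarrow> \<sigma> (\<tau> j) = j"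
    using bij_betw_inv_into bij_betw_inv_into_right by (metis lessThan_iff)
  have "(\<Prod>i<d. y (\<sigma> i) $ w i) = (\<Prod>j<d. y j $ w (\<tau> j))" for y :: "nat \<Rightarrow> complex^'a"
  proof -
    have "(\<Prod>i<d. y (\<sigma> i) $ w i) = (\<Prod>j<d. y (\<sigma> (\<tau> j)) $ w (\<tau> j))"
      by (rule prod.reindex_bij_betw[OF \<tau>(1), symmetric])
    also have "\<dots> = (\<Prod>j<d. y j $ w (\<tau> j))"
      using \<tau>(2) by (intro prod.cong) auto
    finally show ?thesis .
  qed
  then show ?thesis using multiform.monomial[of d c "\<lambda>j. w (\<tau> j)"] by simp
qed

text \<open>A monomial with exponents \<open>a\<close> is read as a word of length \<open>d\<close> in the variables, one letter for
  each slot of its polarization.\<close>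

lemma monomial_as_word:
  fixes a :: "'n::finite \<Rightarrow> nat"
  assumes "(\<Sum>i\<in>UNIV. a i) = d"
  obtains w where "\<And>z :: complex^'n. (\<Prod>i\<in>UNIV. (z $ i) ^ a i) = (\<Prod>j<d. z $ w j)"
proof -
  have "\<exists>w. \<forall>z :: complex^'n. (\<Prod>i\<in>UNIV. (z $ i) ^ a i) = (\<Prod>j<d. z $ w j)"
    using assms
  proof (induction d arbitrary: a)
    case 0
    then show ?case by simp
  next
    case (Suc d)
    then obtain k where k: "a k > 0" by (metis gr0I nat.distinct(1) sum.neutral)
    define a' where "a' = a(k := a k - 1)"
    have "(\<Sum>i\<in>UNIV. a i) = a k + (\<Sum>i\<in>UNIV - {k}. a i)" by (simp add: sum.remove)
    moreover have "(\<Sum>i\<in>UNIV. a' i) = a' k + (\<Sum>i\<in>UNIV - {k}. a' i)" by (simp add: sum.remove)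
    moreover have "(\<Sum>i\<in>UNIV - {k}. a' i) = (\<Sum>i\<in>UNIV - {k}. a i)"
      by (intro sum.cong) (auto simp: a'_def)
    ultimately have "(\<Sum>i\<in>UNIV. a' i) = d" using Suc.prems k by (simp add: a'_def)
    from Suc.IH[OF this] obtain w where w: "\<And>z :: complex^'n. (\<Prod>i\<in>UNIV. (z $ i) ^ a' i) = (\<Prod>j<d. z $ w j)"
      by blast
    have "(\<Prod>i\<in>UNIV. (z $ i) ^ a i) = (\<Prod>j<Suc d. z $ (w(d := k)) j)" for z :: "complex^'n"
    proof -
      have "(\<Prod>i\<in>UNIV. (z $ i) ^ a i) = (z $ k) ^ a k * (\<Prod>i\<in>UNIV - {k}. (z $ i) ^ a i)"
        by (simp add: prod.remove)
      also have "(z $ k) ^ a k = z $ k * (z $ k) ^ a' k"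
        using k by (cases "a k") (auto simp: a'_def)
      also have "(\<Prod>i\<in>UNIV - {k}. (z $ i) ^ a i) = (\<Prod>i\<in>UNIV - {k}. (z $ i) ^ a' i)"
        by (intro prod.cong) (auto simp: a'_def)
      also have "z $ k * (z $ k) ^ a' k * \<dots> = z $ k * (\<Prod>i\<in>UNIV. (z $ i) ^ a' i)"
        by (simp add: prod.remove[of UNIV k] mult.assoc)
      also have "\<dots> = z $ k * (\<Prod>j<d. z $ w j)" by (simp add: w)
      also have "(\<Prod>j<d. z $ w j) = (\<Prod>j<d. z $ (w(d := k)) j)" by (intro prod.cong) auto
      finally show ?thesis by (simp add: mult.commute)
    qed
    then show ?case by blast
  qed
  then show ?thesis using that by blast
qed

lemma polarization_homogeneous:
  fixes f :: "complex^'n \<Rightarrow> complex"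
  assumes "f \<in> homogeneous_polys d"
  shows "multiform d (polarization d f)"
    and "polarization d f (\<lambda>_. z) = (-1) ^ d * of_nat (card (self_surjections d)) * f z"
proof -
  define P where "P f \<longleftrightarrow> multiform d (polarization d f) \<and>
    (\<forall>z. polarization d f (\<lambda>_. z) = (-1) ^ d * of_nat (card (self_surjections d)) * f z)"
    for f :: "complex^'n \<Rightarrow> complex"
  have mono: "P (\<lambda>z. c * (\<Prod>i<d. z $ w i))" for c w
    unfolding P_def
  proof (intro conjI allI)
    show "multiform d (polarization d (\<lambda>z. c * (\<Prod>i<d. z $ w i)))"
      unfolding polarization_monomial[abs_def]
      by (intro multiform_sum multiform_reindexed_monomial)
  qed (simp add: polarization_monomial)
  have padd: "P (\<lambda>z. f z + g z)" if "P f" "P g" for f g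
  proof -
    have "polarization d (\<lambda>z. f z + g z) = (\<lambda>y. polarization d f y + polarization d g y)"
      by (simp add: polarization_def fun_eq_iff distrib_left sum.distrib)
    then show ?thesis using that multiform.add by (auto simp: P_def distrib_left)
  qed
  have psum: "P (\<lambda>z. \<Sum>a\<in>A. c a * (\<Prod>i\<in>UNIV. (z $ i) ^ a i))"
    if "\<forall>a\<in>A. (\<Sum>i\<in>UNIV. a i) = d" for A :: "('n \<Rightarrow> nat) set" and c
    using that
  proof (induction A rule: infinite_finite_induct)
    case (insert a A)
    from insert.prems obtain w
      where "\<And>z :: complex^'n. (\<Prod>i\<in>UNIV. (z $ i) ^ a i) = (\<Prod>j<d. z $ w j)"
      using monomial_as_word[of a d] by auto
    then have "P (\<lambda>z. c a * (\<Prod>i\<in>UNIV. (z $ i) ^ a i))" using mono by simp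
    then show ?case using insert padd by simp
  qed (use mono[of 0] in auto)
  have "P f"
    using assms psum unfolding homogeneous_polys_def by force
  then show "multiform d (polarization d f)"
    "polarization d f (\<lambda>_. z) = (-1) ^ d * of_nat (card (self_surjections d)) * f z"
    by (auto simp: P_def)
qed

lemma polarization_invariant:
  assumes "\<And>z. f (A *v z) = f z"
  shows "polarization d f (\<lambda>j. A *v y j) = polarization d f y"
proof -
  have "(\<Sum>j\<in>S. A *v y j) = A *v (\<Sum>j\<in>S. y j)" for S
    by (induction S rule: infinite_finite_induct) (auto simp: matrix_vector_right_distrib)
  then show ?thesis by (simp add: polarization_def assms)
qed

section \<open>Calculus in charts\<close>

lemma smooth_on_differentiable:
  assumes "smooth_on f S" "x \<in> S"
  shows "f differentiable (at x)"
proof -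
  have "Ck_on (Suc 0) f S" using assms(1) unfolding smooth_on_def by blast
  then show ?thesis using assms(2) by simp
qed

lemma smooth_on_derivative_differentiable:
  assumes "smooth_on f S" "x \<in> S"
  shows "(\<lambda>x. frechet_derivative f (at x) v) differentiable (at x)"
proof -
  have "Ck_on (Suc (Suc 0)) f S" using assms(1) unfolding smooth_on_def by blast
  then show ?thesis using assms(2) by simp
qed

lemma differentiable_transform_open:
  assumes "f differentiable (at x)" "open S" "x \<in> S" "\<And>y. y \<in> S \<Longrightarrow> f y = g y"
  shows "g differentiable (at x)"
  using assms has_derivative_transform_within_open unfolding differentiable_def by blast

lemma has_derivative_frechet:
  "f differentiable (at x) \<Longrightarrow> (f has_derivative frechet_derivative f (at x)) (at x)"
  by (simp add: frechet_derivative_works)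

context lie_group
begin

lemma chart_dom_subset:
  assumes "c \<in> atlas K"
  shows "fst c \<subseteq> carrier K"
  using cover assms by blast

lemma chart_open_dom: "c \<in> atlas K \<Longrightarrow> openin (gtop K) (fst c)"
  using charts[of c] unfolding is_chart_def by auto

lemma chart_open_image: "c \<in> atlas K \<Longrightarrow> open (chart_image c)"
  using charts[of c] unfolding is_chart_def by auto

lemma chart_homeo:
  "c \<in> atlas K \<Longrightarrow> homeomorphic_map (subtopology (gtop K) (fst c)) (top_of_set (chart_image c)) (snd c)"
  using charts[of c] unfolding is_chart_def by auto

lemma chart_inj:
  assumes "c \<in> atlas K"
  shows "inj_on (snd c) (fst c)"
proof -
  have "topspace (subtopology (gtop K) (fst c)) = fst c"
    using chart_dom_subset[OF assms] topspace_eq by auto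
  then show ?thesis using homeomorphic_imp_injective_map[OF chart_homeo[OF assms]] by simp
qed

lemma chart_inv_mem: "x \<in> chart_image c \<Longrightarrow> chart_inv c x \<in> fst c"
  unfolding chart_image_def chart_inv_def by (rule inv_into_into)

lemma chart_of_inv: "x \<in> chart_image c \<Longrightarrow> snd c (chart_inv c x) = x"
  unfolding chart_image_def chart_inv_def by (rule f_inv_into_f)

lemma chart_inv_of: "c \<in> atlas K \<Longrightarrow> g \<in> fst c \<Longrightarrow> chart_inv c (snd c g) = g"
  unfolding chart_inv_def by (simp add: chart_inj)

lemma chart_mem_image: "g \<in> fst c \<Longrightarrow> snd c g \<in> chart_image c"
  unfolding chart_image_def by blast

lemma chart_inv_carrier: "c \<in> atlas K \<Longrightarrow> x \<in> chart_image c \<Longrightarrow> chart_inv c x \<in> carrier K"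
  using chart_inv_mem[of x c] chart_dom_subset[of c] by auto

lemma open_chart_inv_preimage:
  assumes c: "c \<in> atlas K" and W: "openin (gtop K) W"
  shows "open {x \<in> chart_image c. chart_inv c x \<in> W}"
proof -
  have "{x \<in> chart_image c. chart_inv c x \<in> W} = snd c ` (W \<inter> fst c)"
  proof (intro subset_antisym subsetI)
    fix x assume "x \<in> {x \<in> chart_image c. chart_inv c x \<in> W}"
    then show "x \<in> snd c ` (W \<inter> fst c)"
      using chart_inv_mem[of x c] chart_of_inv[of x c] by (intro image_eqI[of _ _ "chart_inv c x"]) auto
  qed (auto simp: chart_inv_of[OF c] chart_mem_image)
  moreover have "openin (subtopology (gtop K) (fst c)) (W \<inter> fst c)"
    using W by (simp add: openin_subtopology_Int)
  then have "openin (top_of_set (chart_image c)) (snd c ` (W \<inter> fst c))"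
    using homeomorphic_map_openness_eq[OF chart_homeo[OF c]] by blast
  ultimately show ?thesis
    using openin_open_trans chart_open_image[OF c] by metis
qed

lemma openin_chart_preimage:
  assumes c: "c \<in> atlas K" and V: "open V"
  shows "openin (gtop K) {g \<in> fst c. snd c g \<in> V}"
proof -
  have "continuous_map (subtopology (gtop K) (fst c)) euclidean (snd c)"
    using homeomorphic_imp_continuous_map[OF chart_homeo[OF c]] continuous_map_into_fulltopology by blast
  then have "openin (subtopology (gtop K) (fst c)) {g \<in> topspace (subtopology (gtop K) (fst c)). snd c g \<in> V}"
    using V by (intro openin_continuous_map_preimage) auto
  moreover have "topspace (subtopology (gtop K) (fst c)) = fst c"
    using chart_dom_subset[OF c] topspace_eq by auto
  ultimately have "openin (subtopology (gtop K) (fst c)) {g \<in> fst c. snd c g \<in> V}"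
    by (simp only:)
  then show ?thesis
    by (simp add: openin_open_subtopology[OF chart_open_dom[OF c]])
qed

lemma continuous_map_left_mult:
  assumes "k \<in> carrier K"
  shows "continuous_map (gtop K) (gtop K) (\<lambda>x. k \<otimes> x)"
proof -
  have "continuous_map (gtop K) (prod_topology (gtop K) (gtop K)) (\<lambda>x. (k, x))"
    using assms by (intro continuous_map_pairedI) (auto simp: topspace_eq)
  from continuous_map_compose[OF this mult_continuous] show ?thesis by (simp add: o_def)
qed

lemma continuous_map_right_mult:
  assumes "k \<in> carrier K"
  shows "continuous_map (gtop K) (gtop K) (\<lambda>x. x \<otimes> k)"
proof -
  have "continuous_map (gtop K) (prod_topology (gtop K) (gtop K)) (\<lambda>x. (x, k))"
    using assms by (intro continuous_map_pairedI) (auto simp: topspace_eq)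
  from continuous_map_compose[OF this mult_continuous] show ?thesis by (simp add: o_def)
qed

text \<open>All differentiation takes place at the identity in the chart selected there: \<open>\<phi>\<close> is the
  coordinate map, \<open>\<psi>\<close> its inverse, and \<open>e0\<close> the coordinates of the identity.\<close>

abbreviation cid where "cid \<equiv> id_chart K"
abbreviation \<phi> where "\<phi> \<equiv> snd (id_chart K)"
abbreviation \<psi> where "\<psi> \<equiv> chart_inv (id_chart K)"
abbreviation e0 where "e0 \<equiv> id_point K"
abbreviation E where "E \<equiv> chart_image (id_chart K)"

lemma id_chart: "cid \<in> atlas K" "\<one> \<in> fst cid"
proof -
  have "\<exists>c. c \<in> atlas K \<and> \<one> \<in> fst c" using cover one_closed by blast
  from someI_ex[OF this] show "cid \<in> atlas K" "\<one> \<in> fst cid" unfolding id_chart_def by auto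
qed

lemma e0_mem: "e0 \<in> E"
  unfolding id_point_def by (rule chart_mem_image[OF id_chart(2)])

lemma \<psi>_e0: "\<psi> e0 = \<one>"
  unfolding id_point_def by (rule chart_inv_of[OF id_chart])

lemma \<psi>_carrier: "x \<in> E \<Longrightarrow> \<psi> x \<in> carrier K"
  by (rule chart_inv_carrier[OF id_chart(1)])

lemma open_E: "open E"
  by (rule chart_open_image[OF id_chart(1)])

lemma open_preimage_near_one:
  assumes "continuous_map (gtop K) (gtop K) f" "openin (gtop K) W"
  shows "open {x \<in> E. f (\<psi> x) \<in> W}"
proof -
  have "openin (gtop K) {g \<in> topspace (gtop K). f g \<in> W}"
    by (rule openin_continuous_map_preimage[OF assms])
  from open_chart_inv_preimage[OF id_chart(1) this]
  have "open {x \<in> E. \<psi> x \<in> carrier K \<and> f (\<psi> x) \<in> W}" by (simp add: topspace_eq)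
  moreover have "{x \<in> E. \<psi> x \<in> carrier K \<and> f (\<psi> x) \<in> W} = {x \<in> E. f (\<psi> x) \<in> W}"
    using \<psi>_carrier by blast
  ultimately show ?thesis by simp
qed

definition differentiable_at_one :: "('g \<Rightarrow> 'x::real_normed_vector) \<Rightarrow> bool" where
  "differentiable_at_one f \<longleftrightarrow> (f \<circ> \<psi>) differentiable (at e0)"

lemma deriv_at_one_works:
  "differentiable_at_one f \<Longrightarrow> ((f \<circ> \<psi>) has_derivative deriv_at_one K f) (at e0)"
  unfolding differentiable_at_one_def deriv_at_one_def by (rule has_derivative_frechet)

lemma deriv_at_one_eq:
  "((f \<circ> \<psi>) has_derivative D) (at e0) \<Longrightarrow> deriv_at_one K f = D"
  unfolding deriv_at_one_def by (rule frechet_derivative_at[symmetric])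

lemma linear_deriv_at_one: "differentiable_at_one f \<Longrightarrow> linear (deriv_at_one K f)"
  by (rule has_derivative_linear[OF deriv_at_one_works])

lemma deriv_at_one_cong:
  assumes "\<And>g. g \<in> carrier K \<Longrightarrow> f g = f' g"
  shows "deriv_at_one K f = deriv_at_one K f'"
proof -
  have eq: "\<And>x. x \<in> E \<Longrightarrow> (f \<circ> \<psi>) x = (f' \<circ> \<psi>) x"
    using assms \<psi>_carrier by simp
  have D: "((f \<circ> \<psi>) has_derivative D) (at e0) \<longleftrightarrow> ((f' \<circ> \<psi>) has_derivative D) (at e0)" for D
    using has_derivative_transform_within_open[OF _ open_E e0_mem, of "f \<circ> \<psi>" D UNIV "f' \<circ> \<psi>"]
      has_derivative_transform_within_open[OF _ open_E e0_mem, of "f' \<circ> \<psi>" D UNIV "f \<circ> \<psi>"] eq by auto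
  show "deriv_at_one K f = deriv_at_one K f'"
    unfolding deriv_at_one_def frechet_derivative_def D ..
qed

lemma deriv_at_one_linear_image:
  assumes "differentiable_at_one f" "bounded_linear L"
  shows "deriv_at_one K (\<lambda>g. L (f g)) = (\<lambda>X. L (deriv_at_one K f X))"
proof -
  have *: "((\<lambda>g. L (f g)) \<circ> \<psi> has_derivative (\<lambda>X. L (deriv_at_one K f X))) (at e0)"
    using bounded_linear.has_derivative[OF assms(2) deriv_at_one_works[OF assms(1)]] by (simp add: o_def)
  show ?thesis using deriv_at_one_eq[OF *] .
qed

section \<open>The adjoint representation\<close>

text \<open>Conjugation by \<open>k\<close> passes from the identity to \<open>k\<close> and back, so it is factored through a
  chart around \<open>k\<close>.\<close>

lemma conj_differentiable:
  assumes k: "k \<in> carrier K"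
  shows "differentiable_at_one (\<lambda>x. \<phi> (k \<otimes> x \<otimes> inv k))"
proof -
  obtain c2 where c2: "c2 \<in> atlas K" "k \<in> fst c2" using cover k by blast
  obtain c3 where c3: "c3 \<in> atlas K" "inv k \<in> fst c3" using cover k by blast
  let ?k = "snd c2 k" and ?k' = "snd c3 (inv k)"
  define L where "L x = snd c2 (k \<otimes> \<psi> x)" for x
  define R where "R u = \<phi> (chart_inv c2 u \<otimes> inv k)" for u
  have "(\<lambda>(x, y). snd c2 (chart_inv c2 x \<otimes> \<psi> y)) differentiable (at (?k, e0))"
    by (rule smooth_on_differentiable[OF mult_smooth[OF c2(1) id_chart(1) c2(1)]])
      (use c2 k e0_mem in \<open>auto simp: chart_mem_image chart_inv_of \<psi>_e0\<close>)
  moreover have "(\<lambda>x. (?k, x)) differentiable (at e0)" by simp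
  ultimately have "((\<lambda>(x, y). snd c2 (chart_inv c2 x \<otimes> \<psi> y)) \<circ> (\<lambda>x. (?k, x))) differentiable (at e0)"
    by (intro differentiable_chain_at) auto
  then have dL: "L differentiable (at e0)"
    using c2 by (simp add: o_def L_def[abs_def] chart_inv_of)
  have "(\<lambda>(x, y). \<phi> (chart_inv c2 x \<otimes> chart_inv c3 y)) differentiable (at (?k, ?k'))"
    by (rule smooth_on_differentiable[OF mult_smooth[OF c2(1) c3(1) id_chart(1)]])
      (use c2 c3 k id_chart in \<open>auto simp: chart_mem_image chart_inv_of\<close>)
  moreover have "(\<lambda>x. (x, ?k')) differentiable (at ?k)" by simp
  ultimately have "((\<lambda>(x, y). \<phi> (chart_inv c2 x \<otimes> chart_inv c3 y)) \<circ> (\<lambda>x. (x, ?k'))) differentiable (at ?k)"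
    by (intro differentiable_chain_at) auto
  then have dR: "R differentiable (at (L e0))"
    using c3 k by (simp add: o_def R_def[abs_def] chart_inv_of L_def \<psi>_e0)
  show ?thesis
    unfolding differentiable_at_one_def
  proof (rule differentiable_transform_open[OF differentiable_chain_at[OF dL dR]])
    show "open {x \<in> E. k \<otimes> \<psi> x \<in> fst c2}"
      by (rule open_preimage_near_one[OF continuous_map_left_mult[OF k] chart_open_dom[OF c2(1)]])
    show "e0 \<in> {x \<in> E. k \<otimes> \<psi> x \<in> fst c2}" using e0_mem c2 k by (simp add: \<psi>_e0)
  qed (simp add: R_def L_def chart_inv_of[OF c2(1)])
qed

lemma continuous_map_conj:
  assumes "k \<in> carrier K"
  shows "continuous_map (gtop K) (gtop K) (\<lambda>x. k \<otimes> x \<otimes> inv k)"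
  using continuous_map_compose[OF continuous_map_left_mult[OF assms] continuous_map_right_mult[of "inv k"]]
    assms by (simp add: o_def)

lemma linear_Ad: "k \<in> carrier K \<Longrightarrow> linear (Ad K k)"
  unfolding Ad_def by (rule linear_deriv_at_one[OF conj_differentiable])

text \<open>The chain rule for conjugation.  Applied to \<open>Ad\<close> itself it makes \<open>Ad k\<close> a homomorphism of the
  bracket, and applied to a representation it makes the differential equivariant.\<close>

lemma deriv_at_one_conj:
  assumes f: "differentiable_at_one f" and k: "k \<in> carrier K"
  shows "deriv_at_one K (\<lambda>x. f (k \<otimes> x \<otimes> inv k)) X = deriv_at_one K f (Ad K k X)"
proof -
  let ?C = "(\<lambda>x. \<phi> (k \<otimes> x \<otimes> inv k)) \<circ> \<psi>"
  have C: "(?C has_derivative Ad K k) (at e0)"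
    unfolding Ad_def by (rule deriv_at_one_works[OF conj_differentiable[OF k]])
  have "?C e0 = e0" using k by (simp add: \<psi>_e0 id_point_def[symmetric])
  then have *: "((f \<circ> \<psi>) \<circ> ?C has_derivative deriv_at_one K f \<circ> Ad K k) (at e0)"
    using diff_chain_at[OF C] deriv_at_one_works[OF f] by simp
  have D: "((\<lambda>x. f (k \<otimes> x \<otimes> inv k)) \<circ> \<psi> has_derivative deriv_at_one K f \<circ> Ad K k) (at e0)"
  proof (rule has_derivative_transform_within_open[OF *])
    show "open {x \<in> E. k \<otimes> \<psi> x \<otimes> inv k \<in> fst cid}"
      using open_preimage_near_one[OF continuous_map_conj[OF k] chart_open_dom[OF id_chart(1)]] .
    show "e0 \<in> {x \<in> E. k \<otimes> \<psi> x \<otimes> inv k \<in> fst cid}"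
      using e0_mem k id_chart by (simp add: \<psi>_e0)
  qed (simp add: chart_inv_of[OF id_chart(1)])
  show ?thesis using deriv_at_one_eq[OF D] by simp
qed

lemma Ad_mult:
  assumes k: "k \<in> carrier K" and h: "h \<in> carrier K"
  shows "Ad K (k \<otimes> h) X = Ad K k (Ad K h X)"
proof -
  have "Ad K k (Ad K h X) = deriv_at_one K (\<lambda>x. \<phi> (k \<otimes> (h \<otimes> x \<otimes> inv h) \<otimes> inv k)) X"
    using deriv_at_one_conj[OF conj_differentiable[OF k] h, of X] by (simp add: Ad_def)
  also have "\<dots> = deriv_at_one K (\<lambda>x. \<phi> (k \<otimes> h \<otimes> x \<otimes> inv (k \<otimes> h))) X"
    using k h by (intro fun_cong[OF deriv_at_one_cong]) (simp add: inv_mult_group m_assoc)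
  finally show ?thesis by (simp add: Ad_def)
qed

lemma Ad_one: "Ad K \<one> X = X"
proof -
  have "((\<lambda>x. x) has_derivative (\<lambda>x. x)) (at e0)" by simp
  then have "((\<lambda>x. \<phi> (\<one> \<otimes> x \<otimes> inv \<one>)) \<circ> \<psi> has_derivative (\<lambda>x. x)) (at e0)"
    by (rule has_derivative_transform_within_open[OF _ open_E e0_mem])
      (simp add: chart_of_inv \<psi>_carrier)
  from deriv_at_one_eq[OF this] show ?thesis by (simp add: Ad_def)
qed

lemma Ad_inv_cancel:
  assumes "k \<in> carrier K"
  shows "Ad K (inv k) (Ad K k X) = X" "Ad K k (Ad K (inv k) X) = X"
  using Ad_mult[of "inv k" k X] Ad_mult[of k "inv k" X] assms by (simp_all add: Ad_one)

text \<open>In the chart \<open>\<psi>\<close> around the identity, write \<open>m\<close> for the multiplication and \<open>\<iota>\<close> for the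
  inversion.  The chain rule gives \<open>Ad (\<psi> a) Z = D\<^sub>1m(a, \<iota> a) (D\<^sub>2m(a, e\<^sub>0) Z)\<close> for \<open>a\<close> near
  \<open>e\<^sub>0\<close>, and this is differentiable in \<open>a\<close> because \<open>m\<close> is twice differentiable.\<close>

lemma Ad_differentiable: "differentiable_at_one (\<lambda>g. Ad K g Z)"
proof -
  define m where "m = (\<lambda>(x, y). \<phi> (\<psi> x \<otimes> \<psi> y))"
  define S where "S = {(x, y). x \<in> E \<and> y \<in> E \<and> \<psi> x \<otimes> \<psi> y \<in> fst cid}"
  define m' where "m' p = frechet_derivative m (at p)" for p
  define \<iota> where "\<iota> a = \<phi> (inv (\<psi> a))" for a
  define N where "N = {a \<in> E. inv (\<psi> a) \<in> fst cid}"
  have smooth: "smooth_on m S"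
    unfolding m_def S_def by (rule mult_smooth[OF id_chart(1) id_chart(1) id_chart(1)])
  have dm: "(m has_derivative m' p) (at p)" if "p \<in> S" for p
    unfolding m'_def using smooth_on_differentiable[OF smooth that] by (rule has_derivative_frechet)
  have dm': "(\<lambda>p. m' p v) differentiable (at p)" if "p \<in> S" for p v
    unfolding m'_def using smooth_on_derivative_differentiable[OF smooth that] .
  have N: "open N" "e0 \<in> N"
    unfolding N_def using open_preimage_near_one[OF inv_continuous chart_open_dom[OF id_chart(1)]]
      e0_mem id_chart by (auto simp: \<psi>_e0)
  have d\<iota>: "\<iota> differentiable (at e0)"
    unfolding \<iota>_def using smooth_on_differentiable[OF inv_smooth[OF id_chart(1) id_chart(1)]] N
    by (simp add: N_def)
  have \<iota>: "\<iota> a \<in> E" "\<psi> (\<iota> a) = inv (\<psi> a)" if "a \<in> N" for a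
    using that by (auto simp: \<iota>_def N_def chart_mem_image chart_inv_of[OF id_chart(1)])
  have S1: "(a, e0) \<in> S" if "a \<in> N" for a
    using that e0_mem by (auto simp: S_def N_def \<psi>_e0 \<psi>_carrier chart_inv_mem)
  have S2: "(a, \<iota> a) \<in> S" if "a \<in> N" for a
    using that \<iota>[OF that] id_chart by (auto simp: S_def N_def \<psi>_carrier)
  have Ad: "Ad K (\<psi> a) X = m' (a, \<iota> a) (m' (a, e0) (0, X), 0)" if a: "a \<in> N" for a X
  proof -
    have aE: "a \<in> E" "\<psi> a \<in> carrier K" using a \<psi>_carrier by (auto simp: N_def)
    have d2: "(m \<circ> (\<lambda>x. (a, x)) has_derivative m' (a, e0) \<circ> (\<lambda>h. (0, h))) (at e0)"
      by (rule diff_chain_at[where f = "\<lambda>x. (a, x)"]) (auto intro!: derivative_eq_intros dm S1 a)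
    have at_e0: "(m \<circ> (\<lambda>x. (a, x))) e0 = a"
      using aE by (simp add: m_def \<psi>_e0 chart_of_inv)
    have d1: "(m \<circ> (\<lambda>x. (x, \<iota> a)) has_derivative m' (a, \<iota> a) \<circ> (\<lambda>h. (h, 0))) (at a)"
      by (rule diff_chain_at[where f = "\<lambda>x. (x, \<iota> a)"]) (auto intro!: derivative_eq_intros dm S2 a)
    have *: "((m \<circ> (\<lambda>x. (x, \<iota> a))) \<circ> (m \<circ> (\<lambda>x. (a, x))) has_derivative
        (m' (a, \<iota> a) \<circ> (\<lambda>h. (h, 0))) \<circ> (m' (a, e0) \<circ> (\<lambda>h. (0, h)))) (at e0)"
      by (rule diff_chain_at[OF d2]) (use d1 at_e0 in \<open>simp add: o_def\<close>)
    have "((\<lambda>x. \<phi> (\<psi> a \<otimes> x \<otimes> inv (\<psi> a))) \<circ> \<psi> has_derivative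
        (m' (a, \<iota> a) \<circ> (\<lambda>h. (h, 0))) \<circ> (m' (a, e0) \<circ> (\<lambda>h. (0, h)))) (at e0)"
    proof (rule has_derivative_transform_within_open[OF *])
      show "open {x \<in> E. \<psi> a \<otimes> \<psi> x \<in> fst cid}"
        using open_preimage_near_one[OF continuous_map_left_mult[OF aE(2)] chart_open_dom[OF id_chart(1)]] .
      show "e0 \<in> {x \<in> E. \<psi> a \<otimes> \<psi> x \<in> fst cid}"
        using e0_mem aE by (simp add: \<psi>_e0 chart_inv_mem)
    qed (simp add: m_def \<iota>(2)[OF a] chart_inv_of[OF id_chart(1)])
    from deriv_at_one_eq[OF this] show ?thesis by (simp add: Ad_def)
  qed
  define A where "A a = (\<Sum>b\<in>Basis. (m' (a, e0) (0, Z) \<bullet> b) *\<^sub>R m' (a, \<iota> a) (b, 0))" for a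
  have pair: "(\<lambda>a. m' (a, f a) v) differentiable (at e0)"
    if "f differentiable (at e0)" "(e0, f e0) \<in> S" for f v
  proof -
    have "(\<lambda>a. (a, f a)) differentiable (at e0)" using that by simp
    from differentiable_chain_at[OF this dm'[OF that(2), of v]] show ?thesis by (simp add: o_def)
  qed
  have "A differentiable (at e0)"
    unfolding A_def[abs_def]
    by (intro differentiable_sum ballI differentiable_scaleR differentiable_inner pair d\<iota> S1 S2 N) auto
  moreover have "A a = Ad K (\<psi> a) Z" if a: "a \<in> N" for a
  proof -
    have lin: "linear (m' (a, \<iota> a))" by (rule has_derivative_linear[OF dm[OF S2[OF a]]])
    have lin': "linear (\<lambda>w. m' (a, \<iota> a) (w, 0))"
      using linear_compose[OF _ lin, of "\<lambda>w. (w, 0)"] by (simp add: o_def linear_iff)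
    let ?w = "m' (a, e0) (0, Z)"
    have "m' (a, \<iota> a) (?w, 0) = m' (a, \<iota> a) (\<Sum>b\<in>Basis. (?w \<bullet> b) *\<^sub>R b, 0)"
      by (simp add: euclidean_representation)
    also have "\<dots> = A a"
      using linear_sum[OF lin', of "\<lambda>b. (?w \<bullet> b) *\<^sub>R b" Basis]
      by (simp add: A_def linear_scale[OF lin'])
    finally show ?thesis using Ad[OF a] by simp
  qed
  ultimately show ?thesis
    unfolding differentiable_at_one_def using differentiable_transform_open[OF _ N, of A "(\<lambda>g. Ad K g Z) \<circ> \<psi>"] by simp
qed

section \<open>The bracket\<close>

lemma bracket_has_derivative:
  "((\<lambda>a. Ad K (\<psi> a) Y) has_derivative (\<lambda>X. bracket K X Y)) (at e0)"
  using deriv_at_one_works[OF Ad_differentiable[of Y]] by (simp add: bracket_def o_def)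

lemma bilinear_bracket: "bilinear (bracket K)"
  unfolding bilinear_def
proof (intro conjI allI)
  show "linear (\<lambda>X. bracket K X Y)" for Y
    by (rule has_derivative_linear[OF bracket_has_derivative])
  show "linear (bracket K X)" for X
  proof (rule linearI)
    fix Y Z
    have "((\<lambda>a. Ad K (\<psi> a) Y + Ad K (\<psi> a) Z) has_derivative (\<lambda>X. bracket K X Y + bracket K X Z)) (at e0)"
      by (intro has_derivative_add bracket_has_derivative)
    then have "((\<lambda>a. Ad K (\<psi> a) (Y + Z)) has_derivative (\<lambda>X. bracket K X Y + bracket K X Z)) (at e0)"
      by (rule has_derivative_transform_within_open[OF _ open_E e0_mem])
        (simp add: linear_add[OF linear_Ad] \<psi>_carrier)
    from has_derivative_unique[OF this bracket_has_derivative]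
    show "bracket K X (Y + Z) = bracket K X Y + bracket K X Z" by metis
  next
    fix r Y
    have "((\<lambda>a. r *\<^sub>R Ad K (\<psi> a) Y) has_derivative (\<lambda>X. r *\<^sub>R bracket K X Y)) (at e0)"
      by (intro has_derivative_scaleR_right bracket_has_derivative)
    then have "((\<lambda>a. Ad K (\<psi> a) (r *\<^sub>R Y)) has_derivative (\<lambda>X. r *\<^sub>R bracket K X Y)) (at e0)"
      by (rule has_derivative_transform_within_open[OF _ open_E e0_mem])
        (simp add: linear_scale[OF linear_Ad] \<psi>_carrier)
    from has_derivative_unique[OF this bracket_has_derivative]
    show "bracket K X (r *\<^sub>R Y) = r *\<^sub>R bracket K X Y" by metis
  qed
qed

lemma Ad_bracket:
  assumes k: "k \<in> carrier K"
  shows "Ad K k (bracket K X Y) = bracket K (Ad K k X) (Ad K k Y)"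
proof -
  have bl: "bounded_linear (Ad K k)" using linear_Ad[OF k] by (simp add: linear_conv_bounded_linear)
  have "bracket K (Ad K k X) (Ad K k Y) = deriv_at_one K (\<lambda>g. Ad K (k \<otimes> g \<otimes> inv k) (Ad K k Y)) X"
    using deriv_at_one_conj[OF Ad_differentiable k] by (simp add: bracket_def)
  also have "\<dots> = deriv_at_one K (\<lambda>g. Ad K k (Ad K g Y)) X"
    using k by (intro fun_cong[OF deriv_at_one_cong]) (simp add: Ad_mult Ad_inv_cancel)
  also have "\<dots> = Ad K k (bracket K X Y)"
    using deriv_at_one_linear_image[OF Ad_differentiable bl, of Y] by (simp add: bracket_def)
  finally show ?thesis by simp
qed

text \<open>The Jacobi identity is the derivative of \<open>Ad_bracket\<close> at the identity.\<close>

lemma jacobi: "bracket K Z (bracket K X Y) = bracket K (bracket K Z X) Y + bracket K X (bracket K Z Y)"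
proof -
  have bb: "bounded_bilinear (bracket K)" using bilinear_bracket by (simp add: bilinear_conv_bounded_bilinear)
  have "((\<lambda>a. bracket K (Ad K (\<psi> a) X) (Ad K (\<psi> a) Y)) has_derivative
      (\<lambda>Z. bracket K (Ad K (\<psi> e0) X) (bracket K Z Y) + bracket K (bracket K Z X) (Ad K (\<psi> e0) Y))) (at e0)"
    by (rule bounded_bilinear.FDERIV[OF bb bracket_has_derivative bracket_has_derivative])
  then have "((\<lambda>a. Ad K (\<psi> a) (bracket K X Y)) has_derivative
      (\<lambda>Z. bracket K (Ad K (\<psi> e0) X) (bracket K Z Y) + bracket K (bracket K Z X) (Ad K (\<psi> e0) Y))) (at e0)"
    by (rule has_derivative_transform_within_open[OF _ open_E e0_mem]) (simp add: Ad_bracket \<psi>_carrier)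
  from has_derivative_unique[OF this bracket_has_derivative]
  have "\<forall>Z. bracket K X (bracket K Z Y) + bracket K (bracket K Z X) Y = bracket K Z (bracket K X Y)"
    by (simp add: \<psi>_e0 Ad_one fun_eq_iff)
  then show ?thesis by (metis add.commute)
qed

text \<open>By continuity at the identity \<open>Ad\<close> is bounded near it, and finitely many translates of that
  neighbourhood cover the group.\<close>

lemma Ad_bounded:
  assumes "compact_space (gtop K)"
  obtains M where "\<And>k X. k \<in> carrier K \<Longrightarrow> norm (Ad K k X) \<le> M * norm X"
proof -
  have "\<forall>\<^sub>F a in nhds e0. norm (Ad K (\<psi> a) b) < 2" if "b \<in> Basis" for b
  proof -
    have "isCont (\<lambda>a. Ad K (\<psi> a) b) e0"
      by (rule has_derivative_continuous[OF bracket_has_derivative])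
    then have "isCont (\<lambda>a. norm (Ad K (\<psi> a) b)) e0" by (rule continuous_norm)
    from tendsto_at_iff_tendsto_nhds[THEN iffD1, OF this[unfolded isCont_def]]
    have "((\<lambda>a. norm (Ad K (\<psi> a) b)) \<longlongrightarrow> norm b) (nhds e0)" by (simp add: \<psi>_e0 Ad_one)
    then show ?thesis using that by (intro order_tendstoD(2)) auto
  qed
  then have "\<forall>\<^sub>F a in nhds e0. \<forall>b\<in>Basis. norm (Ad K (\<psi> a) b) < 2"
    by (intro eventually_ball_finite) auto
  then obtain V where V: "open V" "e0 \<in> V" "\<And>a b. a \<in> V \<Longrightarrow> b \<in> Basis \<Longrightarrow> norm (Ad K (\<psi> a) b) < 2"
    unfolding eventually_nhds by blast
  define W where "W = {g \<in> fst cid. \<phi> g \<in> V}"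
  have W: "openin (gtop K) W" "\<one> \<in> W"
    unfolding W_def using openin_chart_preimage[OF id_chart(1) V(1)] id_chart(2) V(2)
    by (auto simp: id_point_def)
  let ?c = "real DIM('e) * 2"
  have near: "norm (Ad K g X) \<le> ?c * norm X" if g: "g \<in> W" for g X
  proof -
    have gc: "g \<in> carrier K" using g chart_dom_subset[OF id_chart(1)] by (auto simp: W_def)
    have bd: "norm (Ad K g b) \<le> 2" if "b \<in> Basis" for b
      using V(3)[of "\<phi> g" b] that g by (simp add: W_def chart_inv_of[OF id_chart(1)])
    have "Ad K g X = (\<Sum>b\<in>Basis. (X \<bullet> b) *\<^sub>R Ad K g b)"
      using linear_sum[OF linear_Ad[OF gc], of "\<lambda>b. (X \<bullet> b) *\<^sub>R b" Basis]
      by (simp add: euclidean_representation linear_scale[OF linear_Ad[OF gc]])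
    also have "norm \<dots> \<le> (\<Sum>b\<in>(Basis::'e set). norm X * 2)"
      by (rule order_trans[OF norm_sum], rule sum_mono)
        (auto intro!: mult_mono Basis_le_norm bd)
    finally show ?thesis by (simp add: mult_ac)
  qed
  define T where "T k = {h \<in> topspace (gtop K). inv k \<otimes> h \<in> W}" for k
  have "openin (gtop K) (T k)" if "k \<in> carrier K" for k
    unfolding T_def
    by (rule openin_continuous_map_preimage[OF continuous_map_left_mult W(1)]) (simp add: that)
  moreover have "k \<in> T k" if "k \<in> carrier K" for k
    using that W by (simp add: T_def topspace_eq)
  ultimately have "(\<forall>U\<in>T ` carrier K. openin (gtop K) U) \<and> topspace (gtop K) \<subseteq> \<Union>(T ` carrier K)"
    by (auto simp: topspace_eq)
  from assms[unfolded compact_space_alt, rule_format, OF this]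
  obtain \<F> where "finite \<F>" "\<F> \<subseteq> T ` carrier K" "carrier K \<subseteq> \<Union>\<F>"
    by (auto simp: topspace_eq)
  then obtain F where F: "finite F" "F \<subseteq> carrier K" "carrier K \<subseteq> (\<Union>k\<in>F. T k)"
    using finite_subset_image[of \<F> T "carrier K"] by blast
  define M where "M = (\<Sum>k\<in>F. onorm (Ad K k)) * ?c"
  have bl: "bounded_linear (Ad K k)" if "k \<in> carrier K" for k
    using linear_Ad[OF that] by (simp add: linear_conv_bounded_linear)
  have "norm (Ad K h X) \<le> M * norm X" if h: "h \<in> carrier K" for h X
  proof -
    obtain k where k: "k \<in> F" "inv k \<otimes> h \<in> W" using F h by (auto simp: T_def)
    have kc: "k \<in> carrier K" using k F by blast
    have "Ad K h X = Ad K k (Ad K (inv k \<otimes> h) X)"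
      using kc h Ad_inv_cancel by (simp add: Ad_mult)
    then have "norm (Ad K h X) \<le> onorm (Ad K k) * norm (Ad K (inv k \<otimes> h) X)"
      using onorm[OF bl[OF kc]] by simp
    also have "\<dots> \<le> (\<Sum>k\<in>F. onorm (Ad K k)) * (?c * norm X)"
      using near[OF k(2)] F k(1) by (intro mult_mono member_le_sum sum_nonneg) (auto intro: onorm_pos_le bl)
    finally show ?thesis by (simp add: M_def mult_ac)
  qed
  then show ?thesis using that by blast
qed

end

section \<open>The Killing form\<close>

lemma endo_trace_commute:
  fixes f g :: "'a::euclidean_space \<Rightarrow> 'a"
  assumes "linear f" "linear g"
  shows "endo_trace (f \<circ> g) = endo_trace (g \<circ> f)"
proof -
  have exp: "endo_trace (f \<circ> g) = (\<Sum>b\<in>Basis. \<Sum>c\<in>Basis. (g b \<bullet> c) * (f c \<bullet> b))"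
    if f: "linear f" for f g :: "'a \<Rightarrow> 'a"
  proof -
    have "f (g b) \<bullet> b = (\<Sum>c\<in>Basis. (g b \<bullet> c) * (f c \<bullet> b))" for b
    proof -
      have "f (g b) = f (\<Sum>c\<in>Basis. (g b \<bullet> c) *\<^sub>R c)" by (simp add: euclidean_representation)
      then show ?thesis by (simp add: linear_sum[OF f] linear_scale[OF f] inner_sum_left)
    qed
    then show ?thesis by (simp add: endo_trace_def)
  qed
  have "endo_trace (f \<circ> g) = (\<Sum>c\<in>Basis. \<Sum>b\<in>Basis. (g b \<bullet> c) * (f c \<bullet> b))"
    unfolding exp[OF assms(1)] by (rule sum.swap)
  also have "\<dots> = endo_trace (g \<circ> f)"
    unfolding exp[OF assms(2)] by (simp add: mult.commute)
  finally show ?thesis .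
qed

locale compact_semisimple_lie_group = lie_group K
  for K :: "('g, 'e::euclidean_space) lie_struct" (structure) +
  assumes compact: "compact_space (gtop K)" and semisimple: "semisimple K"
begin

lemmas bracket_simps =
  bilinear_ladd[OF bilinear_bracket] bilinear_radd[OF bilinear_bracket]
  bilinear_lmul[OF bilinear_bracket] bilinear_rmul[OF bilinear_bracket]
  bilinear_lneg[OF bilinear_bracket] bilinear_rneg[OF bilinear_bracket]
  bilinear_lsub[OF bilinear_bracket] bilinear_rsub[OF bilinear_bracket]
  bilinear_lzero[OF bilinear_bracket] bilinear_rzero[OF bilinear_bracket]

lemma linear_bracket: "linear (bracket K X)" "linear (\<lambda>X. bracket K X Y)"
  using bilinear_bracket unfolding bilinear_def by auto

lemma invariant_form_exists:
  obtains B where "inner_form B" "\<And>k X Y. k \<in> carrier K \<Longrightarrow> B (Ad K k X) (Ad K k Y) = B X Y"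
proof -
  obtain M where M: "\<And>k X. k \<in> carrier K \<Longrightarrow> norm (Ad K k X) \<le> M * norm X"
    using Ad_bounded[OF compact] by blast
  let ?G = "Ad K ` carrier K"
  have lin: "linear g" if "g \<in> ?G" for g
  proof -
    obtain x where "x \<in> carrier K" "g = Ad K x" using \<open>g \<in> ?G\<close> by blast
    then show ?thesis by (simp add: linear_Ad)
  qed
  have comp: "g \<circ> h \<in> ?G" if "g \<in> ?G" "h \<in> ?G" for g h
  proof -
    obtain x y where xy: "x \<in> carrier K" "g = Ad K x" "y \<in> carrier K" "h = Ad K y"
      using \<open>g \<in> ?G\<close> \<open>h \<in> ?G\<close> by (metis imageE)
    then have "g \<circ> h = Ad K (x \<otimes> y)" by (simp add: fun_eq_iff Ad_mult)
    then show ?thesis using xy by (metis imageI m_closed)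
  qed
  have "id = Ad K \<one>" by (simp add: fun_eq_iff Ad_one)
  then have one: "id \<in> ?G" by (metis imageI one_closed)
  have inverse: "\<exists>h\<in>?G. g \<circ> h = id" if "g \<in> ?G" for g
  proof -
    obtain x where x: "x \<in> carrier K" "g = Ad K x" using \<open>g \<in> ?G\<close> by blast
    then have "g \<circ> Ad K (inv x) = id" by (simp add: fun_eq_iff Ad_inv_cancel)
    then show ?thesis using x(1) by (metis imageI inv_closed)
  qed
  have bound: "norm (g x) \<le> M * norm x" if "g \<in> ?G" for g x
  proof -
    obtain k where "k \<in> carrier K" "g = Ad K k" using \<open>g \<in> ?G\<close> by blast
    then show ?thesis using M by simp
  qed
  obtain B where B: "inner_form B" "\<And>g x y. g \<in> ?G \<Longrightarrow> B (g x) (g y) = B x y"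
    by (rule bounded_group_preserves_inner_form[where G = ?G and M = M])
      (erule lin, erule (1) comp, rule one, erule inverse, erule bound, blast)
  show ?thesis by (rule that[OF B(1)]) (rule B(2)[OF imageI])
qed

text \<open>The derivative of \<open>B (Ad k X) (Ad k Y) = B X Y\<close> at the identity.\<close>

lemma invariant_form_skew:
  assumes "inner_form B" and inv: "\<And>k X Y. k \<in> carrier K \<Longrightarrow> B (Ad K k X) (Ad K k Y) = B X Y"
  shows "B (bracket K Z X) Y = - B X (bracket K Z Y)"
proof -
  interpret inner_form B by fact
  have bb: "bounded_bilinear B" using bilin by (simp add: bilinear_conv_bounded_bilinear)
  have "((\<lambda>a. B (Ad K (\<psi> a) X) (Ad K (\<psi> a) Y)) has_derivative
      (\<lambda>Z. B (Ad K (\<psi> e0) X) (bracket K Z Y) + B (bracket K Z X) (Ad K (\<psi> e0) Y))) (at e0)"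
    by (rule bounded_bilinear.FDERIV[OF bb bracket_has_derivative bracket_has_derivative])
  then have "((\<lambda>a. B X Y) has_derivative
      (\<lambda>Z. B (Ad K (\<psi> e0) X) (bracket K Z Y) + B (bracket K Z X) (Ad K (\<psi> e0) Y))) (at e0)"
    by (rule has_derivative_transform_within_open[OF _ open_E e0_mem]) (simp add: inv \<psi>_carrier)
  from has_derivative_unique[OF this has_derivative_const]
  have "B X (bracket K Z Y) + B (bracket K Z X) Y = 0"
    by (simp add: \<psi>_e0 Ad_one fun_eq_iff)
  then show ?thesis by linarith
qed

text \<open>The kernel of \<open>ad\<close> is an abelian ideal, hence solvable.\<close>

lemma ad_injective:
  assumes "\<And>Y. bracket K X Y = 0"
  shows "X = 0"
proof -
  define I where "I = {X. \<forall>Y. bracket K X Y = 0}"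
  have "subspace I" unfolding I_def subspace_def by (simp add: bracket_simps)
  moreover have "bracket K X Y \<in> I" if "Y \<in> I" for X Y
    unfolding I_def
  proof (intro CollectI allI)
    fix Z
    show "bracket K (bracket K X Y) Z = 0"
      using jacobi[of X Y Z] that by (simp add: I_def bracket_simps)
  qed
  ultimately have "lie_ideal K I" unfolding lie_ideal_def by blast
  moreover have "lie_solvable K I"
  proof -
    have "{bracket K X Y | X Y. X \<in> I \<and> Y \<in> I} \<subseteq> {0}" unfolding I_def by auto
    then have "derived_algebra K I \<subseteq> {0}"
      unfolding derived_algebra_def using span_mono[of _ "{0}"] by simp
    moreover have "0 \<in> derived_algebra K I" unfolding derived_algebra_def by (rule span_zero)
    ultimately have "(derived_algebra K ^^ 1) I = {0}" by auto
    then show ?thesis unfolding lie_solvable_def by blast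
  qed
  ultimately have "I = {0}" using semisimple unfolding semisimple_def by blast
  then show ?thesis using assms unfolding I_def by blast
qed

text \<open>The Jacobi identity in the form \<open>jacobi\<close> shows that \<open>[X, X]\<close> acts as
  \<open>ad X \<circ> ad X - ad X \<circ> ad X = 0\<close>; by \<open>ad_injective\<close> it vanishes.\<close>

lemma bracket_self: "bracket K X X = 0"
proof (rule ad_injective)
  show "bracket K (bracket K X X) Y = 0" for Y using jacobi[of X X Y] by simp
qed

lemma bracket_antisym: "bracket K X Y = - bracket K Y X"
proof -
  have "bracket K X Y + bracket K Y X = 0"
    using bracket_self[of "X + Y"] bracket_self[of X] bracket_self[of Y]
    by (simp add: bracket_simps add.commute)
  then show ?thesis by (simp add: eq_neg_iff_add_eq_0)
qed

lemma killing_form_commute: "killing_form K X Y = killing_form K Y X"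
  unfolding killing_form_def by (rule endo_trace_commute) (rule linear_bracket)+

text \<open>With respect to an invariant inner product the operators \<open>ad X\<close> are skew, so that
  \<open>- tr (ad X \<circ> ad X)\<close> is the sum of the squared norms of the vectors \<open>[X, u]\<close>, where \<open>u\<close> runs over
  an orthonormal basis.\<close>

lemma kform_inner_form: "inner_form (kform K)"
proof
  have r: "linear (kform K X)" for X
    by (rule linearI)
      (simp_all add: kform_def killing_form_def endo_trace_def bracket_simps inner_add_left
        sum.distrib sum_distrib_left)
  show sym: "kform K X Y = kform K Y X" for X Y
    unfolding kform_def using killing_form_commute by simp
  show "bilinear (kform K)"
    unfolding bilinear_def using r sym by (metis (no_types, lifting) ext)
  show "kform K X X > 0" if "X \<noteq> 0" for X
  proof -
    obtain B where B: "inner_form B" "\<And>k X Y. k \<in> carrier K \<Longrightarrow> B (Ad K k X) (Ad K k Y) = B X Y"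
      using invariant_form_exists by blast
    interpret B: inner_form B by fact
    obtain U where U: "B.orthonormal U" "span U = UNIV"
      using B.orthonormal_basis_exists[OF subspace_UNIV] .
    have "endo_trace (bracket K X \<circ> bracket K X) = (\<Sum>u\<in>U. B ((bracket K X \<circ> bracket K X) u) u)"
      by (rule B.endo_trace_orthonormal[OF U]) (intro linear_compose linear_bracket)
    then have eq: "kform K X X = (\<Sum>u\<in>U. B (bracket K X u) (bracket K X u))"
      by (simp add: kform_def killing_form_def invariant_form_skew[OF B] sum_negf)
    have "\<exists>u\<in>U. bracket K X u \<noteq> 0"
    proof (rule ccontr)
      assume "\<not> ?thesis"
      then have "bracket K X Y = 0" for Y
        using linear_eq_0_on_span[OF linear_bracket(1), of U X Y] U(2) by simp
      then show False using ad_injective \<open>X \<noteq> 0\<close> by blast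
    qed
    then show ?thesis
      unfolding eq using U(1) B.nonneg B.pos by (auto simp: B.orthonormal_def intro!: sum_pos2)
  qed
qed

sublocale kf: inner_form "kform K"
  by (rule kform_inner_form)

lemma kform_Ad:
  assumes k: "k \<in> carrier K"
  shows "kform K (Ad K k X) (Ad K k Y) = kform K X Y"
proof -
  let ?f = "bracket K X \<circ> bracket K Y"
  have ad: "bracket K (Ad K k X) Z = Ad K k (bracket K X (Ad K (inv k) Z))" for X Z
    using k by (simp add: Ad_bracket Ad_inv_cancel)
  have lin: "linear ?f" by (intro linear_compose linear_bracket)
  have "bracket K (Ad K k X) \<circ> bracket K (Ad K k Y) = (Ad K k \<circ> ?f) \<circ> Ad K (inv k)"
    using k by (simp add: fun_eq_iff ad Ad_inv_cancel)
  then have "killing_form K (Ad K k X) (Ad K k Y) = endo_trace ((Ad K k \<circ> ?f) \<circ> Ad K (inv k))"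
    by (simp add: killing_form_def)
  also have "\<dots> = endo_trace (Ad K (inv k) \<circ> (Ad K k \<circ> ?f))"
    using k by (intro endo_trace_commute linear_compose[OF lin] linear_Ad) auto
  also have "Ad K (inv k) \<circ> (Ad K k \<circ> ?f) = ?f"
    using k by (simp add: fun_eq_iff Ad_inv_cancel)
  finally have "killing_form K (Ad K k X) (Ad K k Y) = killing_form K X Y"
    by (simp only: killing_form_def)
  then show ?thesis by (simp add: kform_def)
qed

lemma kform_skew: "kform K (bracket K Z X) Y = - kform K X (bracket K Z Y)"
  using invariant_form_skew[where B = "kform K" and X = X and Y = Y and Z = Z] kform_inner_form kform_Ad
  by simp

section \<open>The root space decomposition\<close>

text \<open>Conjugation sends \<open>X + \<i>Y\<close> to \<open>X - \<i>Y\<close>, and \<open>\<i>\<close> times this is \<open>Y + \<i>X\<close>; it exchanges the root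
  spaces of \<open>\<alpha>\<close> and \<open>- \<alpha>\<close>.\<close>

lemma in_root_space_swap:
  "in_root_space K t \<alpha> X Y \<longleftrightarrow> in_root_space K t (- \<alpha>) Y X"
  "in_root_space K t \<alpha> X Y \<longleftrightarrow> in_root_space K t (- \<alpha>) X (- Y)"
  unfolding in_root_space_def by (auto simp: kf.B_simps bracket_simps)

lemma uminus_root:
  assumes "subspace t" "\<alpha> \<in> roots K t"
  shows "- \<alpha> \<in> roots K t"
proof -
  obtain X Y where XY: "(X, Y) \<noteq> (0, 0)" "in_root_space K t \<alpha> X Y" "\<alpha> \<in> t" "\<alpha> \<noteq> 0"
    using assms(2) unfolding roots_def by blast
  then have "in_root_space K t (- \<alpha>) Y X" "(Y, X) \<noteq> (0, 0)"
    using in_root_space_swap(1) by auto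
  moreover have "- \<alpha> \<in> t" "- \<alpha> \<noteq> 0" using XY(3,4) subspace_neg[OF assms(1)] by auto
  ultimately show ?thesis unfolding roots_def by blast
qed

definition root_vectors :: "'e set \<Rightarrow> 'e set" where
  "root_vectors t = {X. \<exists>\<alpha>\<in>roots K t. \<exists>Y. in_root_space K t \<alpha> X Y}"

lemma bracket_root_vector:
  assumes "subspace t" "X \<in> root_vectors t" "H \<in> t"
  shows "bracket K H X \<in> span (root_vectors t)"
proof -
  obtain \<alpha> Y where Y: "\<alpha> \<in> roots K t" "in_root_space K t \<alpha> X Y"
    using assms(2) unfolding root_vectors_def by blast
  then have "Y \<in> root_vectors t"
    using in_root_space_swap(1) uminus_root[OF assms(1)] unfolding root_vectors_def by blast
  moreover have "bracket K H X = (- kform K \<alpha> H) *\<^sub>R Y"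
    using Y(2) assms(3) unfolding in_root_space_def by simp
  ultimately show ?thesis by (simp only: span_scale span_base)
qed

text \<open>A root vector \<open>X\<close> is a multiple of \<open>[\<alpha>, Y]\<close>, and \<open>ad \<alpha>\<close> is skew and kills \<open>\<mu>\<close>.\<close>

lemma kform_root_vector:
  assumes t: "abelian_subalgebra K t" and "\<mu> \<in> t" "X \<in> root_vectors t"
  shows "kform K \<mu> X = 0"
proof -
  obtain \<alpha> Y where \<alpha>: "\<alpha> \<in> roots K t" "in_root_space K t \<alpha> X Y"
    using assms(3) unfolding root_vectors_def by blast
  then have "\<alpha> \<in> t" "\<alpha> \<noteq> 0" unfolding roots_def by auto
  have "kform K \<alpha> \<alpha> * kform K \<mu> X = kform K \<mu> (bracket K \<alpha> Y)"
    using \<alpha>(2) \<open>\<alpha> \<in> t\<close> unfolding in_root_space_def by (simp add: kf.B_simps)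
  also have "\<dots> = - kform K (bracket K \<alpha> \<mu>) Y" by (simp add: kform_skew)
  also have "bracket K \<alpha> \<mu> = 0" using t \<open>\<alpha> \<in> t\<close> assms(2) unfolding abelian_subalgebra_def by blast
  finally show ?thesis using kf.eq_0_iff \<open>\<alpha> \<noteq> 0\<close> by (simp add: kf.B_simps)
qed

lemma maximal_abelian_self_centralizing:
  assumes t: "maximal_abelian K t" and u: "\<And>H. H \<in> t \<Longrightarrow> bracket K H u = 0"
  shows "u \<in> t"
proof -
  have ab: "abelian_subalgebra K t" and sub: "subspace t"
    using t unfolding maximal_abelian_def abelian_subalgebra_def by auto
  have u': "bracket K u H = 0" if "H \<in> t" for H using u[OF that] bracket_antisym[of u H] by simp
  define s where "s = span (insert u t)"
  have s: "s = {x. \<exists>k. x - k *\<^sub>R u \<in> t}"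
  proof -
    have "span t = t" using sub by (simp only: span_eq_iff)
    then show ?thesis by (simp only: s_def span_insert)
  qed
  have "bracket K X Y = 0" if XY: "X \<in> s" "Y \<in> s" for X Y
  proof -
    obtain k l where kl: "X - k *\<^sub>R u \<in> t" "Y - l *\<^sub>R u \<in> t" using XY unfolding s by blast
    have "bracket K X Y = bracket K ((X - k *\<^sub>R u) + k *\<^sub>R u) ((Y - l *\<^sub>R u) + l *\<^sub>R u)" by simp
    also have "\<dots> = 0"
      unfolding bilinear_ladd[OF bilinear_bracket] bilinear_radd[OF bilinear_bracket]
        bilinear_lmul[OF bilinear_bracket] bilinear_rmul[OF bilinear_bracket]
      using ab kl u[OF kl(1)] u'[OF kl(2)] bracket_self[of u] unfolding abelian_subalgebra_def by simp
    finally show ?thesis .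
  qed
  then have "abelian_subalgebra K s" unfolding abelian_subalgebra_def s_def by auto
  moreover have "t \<subseteq> s" unfolding s_def by (auto intro: span_base)
  ultimately have "s = t" using t unfolding maximal_abelian_def by blast
  then show ?thesis unfolding s_def using span_base[of u "insert u t"] by blast
qed

lemma ad_commute:
  assumes "abelian_subalgebra K t" "H \<in> t" "H' \<in> t"
  shows "bracket K H (bracket K H' X) = bracket K H' (bracket K H X)"
proof -
  have "bracket K H H' = 0" using assms unfolding abelian_subalgebra_def by blast
  then show ?thesis using jacobi[of H H' X] by (simp add: bracket_simps)
qed

text \<open>On an irreducible \<open>t\<close>-module the symmetric operators \<open>ad H \<circ> ad H'\<close>, which commute with the
  action of \<open>t\<close>, are scalars: their eigenspaces are submodules.  So either \<open>t\<close> acts trivially or all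
  operators \<open>ad H\<close> are multiples of one of them, whose square is negative.  In the first case the
  module lies in \<open>t\<close> by maximality, in the second it consists of root vectors.\<close>

lemma irreducible_torus_module_contains_root_vector:
  assumes t: "maximal_abelian K t"
    and U: "subspace U" "U \<noteq> {0}" "\<And>H x. H \<in> t \<Longrightarrow> x \<in> U \<Longrightarrow> bracket K H x \<in> U"
    and min: "\<And>U'. subspace U' \<Longrightarrow> U' \<subseteq> U \<Longrightarrow> U' \<noteq> {0} \<Longrightarrow>
      (\<And>H x. H \<in> t \<Longrightarrow> x \<in> U' \<Longrightarrow> bracket K H x \<in> U') \<Longrightarrow> U' = U"
  obtains x where "x \<in> U" "x \<noteq> 0" "x \<in> t \<union> root_vectors t"
proof -
  have ab: "abelian_subalgebra K t" and sub: "subspace t"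
    using t unfolding maximal_abelian_def abelian_subalgebra_def by auto
  note comm = ad_commute[OF ab]
  have scalar: "\<exists>c. \<forall>x\<in>U. bracket K H (bracket K H' x) = c *\<^sub>R x" if H: "H \<in> t" "H' \<in> t" for H H'
  proof -
    let ?A = "\<lambda>x. bracket K H (bracket K H' x)"
    have A: "linear ?A"
      using linear_compose[OF linear_bracket(1) linear_bracket(1), of H H'] by (simp add: o_def)
    obtain c x where x: "x \<in> U" "x \<noteq> 0" "?A x = c *\<^sub>R x"
    proof (rule kf.symmetric_eigenvector[OF U(1,2) A])
      show "?A x \<in> U" if "x \<in> U" for x using U(3) H that by blast
      show "kform K (?A x) y = kform K x (?A y)" for x y
        by (simp add: kform_skew kf.B_simps comm[OF H])
    qed blast
    define U' where "U' = {x \<in> U. ?A x = c *\<^sub>R x}"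
    have "U' = U"
    proof (rule min)
      show "subspace U'"
        unfolding U'_def using U(1) by (auto simp: subspace_def bracket_simps scaleR_add_right)
      show "U' \<noteq> {0}" unfolding U'_def using x by blast
      show "bracket K J x \<in> U'" if "J \<in> t" "x \<in> U'" for J x
      proof -
        have "?A (bracket K J x) = bracket K J (?A x)"
          using that(1) H by (simp add: comm[of H' J] comm[of H J])
        then show ?thesis using that U(3) unfolding U'_def by (simp add: bracket_simps)
      qed
    qed (auto simp: U'_def)
    then show ?thesis unfolding U'_def by blast
  qed
  show ?thesis
  proof (cases "\<forall>H\<in>t. \<forall>x\<in>U. bracket K H x = 0")
    case True
    obtain u where u: "u \<in> U" "u \<noteq> 0" using U(1,2) subspace_0 by blast
    then have "u \<in> t" using True maximal_abelian_self_centralizing[OF t] by blast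
    then show ?thesis using that u by blast
  next
    case False
    then obtain H0 x where H0: "H0 \<in> t" "x \<in> U" "bracket K H0 x \<noteq> 0" by blast
    have "x \<noteq> 0" using H0(3) by (auto simp: bracket_simps)
    obtain d where d: "\<And>y. y \<in> U \<Longrightarrow> bracket K H0 (bracket K H0 y) = d *\<^sub>R y"
      using scalar[OF H0(1) H0(1)] by blast
    have "d * kform K x x = - kform K (bracket K H0 x) (bracket K H0 x)"
      using d[OF H0(2)] kform_skew[of H0 "bracket K H0 x" x] by (simp add: kf.B_simps)
    moreover have "kform K (bracket K H0 x) (bracket K H0 x) > 0" "kform K x x > 0"
      using kf.pos H0(3) \<open>x \<noteq> 0\<close> by auto
    ultimately have "d < 0" by (smt (verit) mult_nonneg_nonneg)
    \<comment> \<open>\<open>ad H0\<close> is \<open>c\<close> times a complex structure, which sends \<open>x\<close> to \<open>J\<close>; the other operators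
      \<open>ad H\<close> are real multiples of it, and the multiple, as a linear form in \<open>H\<close>, is the root.\<close>
    define c where "c = sqrt (- d)"
    have c: "c > 0" "d = - (c * c)" using \<open>d < 0\<close> by (auto simp: c_def)
    define J where "J = (1 / c) *\<^sub>R bracket K H0 x"
    have J: "J \<noteq> 0" "bracket K H0 x = c *\<^sub>R J" using c H0(3) by (auto simp: J_def)
    define a where "a H = kform K (bracket K H x) J / kform K J J" for H
    have act: "bracket K H x = a H *\<^sub>R J" "bracket K H J = - (a H *\<^sub>R x)" if H: "H \<in> t" for H
    proof -
      obtain e where e: "\<And>y. y \<in> U \<Longrightarrow> bracket K H (bracket K H0 y) = e *\<^sub>R y"
        using scalar[OF H H0(1)] by blast
      have "d *\<^sub>R bracket K H x = bracket K H (bracket K H0 (bracket K H0 x))"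
        using d[OF H0(2)] by (simp add: bracket_simps)
      also have "\<dots> = e *\<^sub>R (c *\<^sub>R J)"
        using e[OF U(3)[OF H0(1,2)]] J(2) by simp
      finally have "(1 / d) *\<^sub>R (d *\<^sub>R bracket K H x) = (1 / d) *\<^sub>R (e *\<^sub>R (c *\<^sub>R J))" by simp
      then have Hx: "bracket K H x = (e * c / d) *\<^sub>R J" using \<open>d < 0\<close> by simp
      then have aH: "a H = e * c / d"
        unfolding a_def using kf.pos[OF J(1)] by (simp add: kf.B_simps)
      show "bracket K H x = a H *\<^sub>R J" using Hx aH by simp
      have "bracket K H J = (e / c) *\<^sub>R x"
        using e[OF H0(2)] by (simp add: J_def bracket_simps)
      moreover have "e / c = - a H" using c by (simp add: aH field_simps)
      ultimately show "bracket K H J = - (a H *\<^sub>R x)" by simp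
    qed
    have "linear a"
      unfolding a_def
      by (rule linearI) (simp_all add: bracket_simps kf.B_simps add_divide_distrib)
    then obtain \<alpha> where \<alpha>: "\<alpha> \<in> t" "\<And>H. H \<in> t \<Longrightarrow> a H = kform K \<alpha> H"
      using kf.riesz_representation[OF sub] by blast
    have "in_root_space K t \<alpha> x (- J)"
      unfolding in_root_space_def using act \<alpha>(2) by (simp add: bracket_simps)
    moreover have "a H0 = c"
      unfolding a_def J(2) using kf.pos[OF J(1)] by (simp add: kf.B_simps)
    then have "\<alpha> \<noteq> 0" using \<alpha>(2)[OF H0(1)] c(1) by (auto simp: kf.B_simps)
    ultimately have "\<alpha> \<in> roots K t" "x \<in> root_vectors t"
      using \<alpha>(1) \<open>x \<noteq> 0\<close> unfolding roots_def root_vectors_def by blast+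
    then show ?thesis using that H0(2) \<open>x \<noteq> 0\<close> by blast
  qed
qed

text \<open>Otherwise a nonzero submodule of minimal dimension of the orthogonal complement would contain
  a nonzero element of \<open>t\<close> or a nonzero root vector, which would be orthogonal to itself.\<close>

lemma root_space_decomposition:
  assumes t: "maximal_abelian K t"
  shows "span (t \<union> root_vectors t) = UNIV"
proof -
  have ab: "abelian_subalgebra K t" and sub: "subspace t"
    using t unfolding maximal_abelian_def abelian_subalgebra_def by auto
  define W where "W = span (t \<union> root_vectors t)"
  have inv: "bracket K H x \<in> W" if H: "H \<in> t" and "x \<in> W" for H x
  proof -
    have "bracket K H x \<in> W" if "x \<in> t \<union> root_vectors t" for x
    proof (cases "x \<in> t")
      case True
      then have "bracket K H x = 0" using ab H unfolding abelian_subalgebra_def by blast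
      then show ?thesis unfolding W_def by (simp add: span_zero)
    next
      case False
      then show ?thesis
        using bracket_root_vector[OF sub _ H] that span_mono[of "root_vectors t" "t \<union> root_vectors t"]
        unfolding W_def by blast
    qed
    then have "bracket K H ` (t \<union> root_vectors t) \<subseteq> W" by blast
    then have "span (bracket K H ` (t \<union> root_vectors t)) \<subseteq> W"
      unfolding W_def by (intro span_minimal) auto
    then show ?thesis
      using \<open>x \<in> W\<close> linear_span_image[OF linear_bracket(1), of H "t \<union> root_vectors t"]
      unfolding W_def by blast
  qed
  define P where "P U \<longleftrightarrow> subspace U \<and> U \<subseteq> kf.orth_complement W \<and> U \<noteq> {0} \<and>
    (\<forall>H\<in>t. \<forall>x\<in>U. bracket K H x \<in> U)" for U
  have "kf.orth_complement W = {0}"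
  proof (rule ccontr)
    assume "kf.orth_complement W \<noteq> {0}"
    moreover have "bracket K H x \<in> kf.orth_complement W" if "H \<in> t" "x \<in> kf.orth_complement W" for H x
      unfolding kf.orth_complement_def
    proof (intro CollectI ballI)
      fix s assume "s \<in> W"
      have "kform K s (bracket K H x) = - kform K (bracket K H s) x" by (simp add: kform_skew)
      then show "kform K s (bracket K H x) = 0"
        using inv[OF that(1) \<open>s \<in> W\<close>] that(2) unfolding kf.orth_complement_def by simp
    qed
    ultimately have "P (kf.orth_complement W)"
      unfolding P_def using kf.subspace_orth_complement by blast
    then obtain U where U: "P U" and least: "\<And>U'. P U' \<Longrightarrow> dim U \<le> dim U'"
      using ex_has_least_nat[of P _ dim] by blast
    obtain x where x: "x \<in> U" "x \<noteq> 0" "x \<in> t \<union> root_vectors t"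
    proof (rule irreducible_torus_module_contains_root_vector[OF t])
      show "U' = U" if "subspace U'" "U' \<subseteq> U" "U' \<noteq> {0}"
        "\<And>H x. H \<in> t \<Longrightarrow> x \<in> U' \<Longrightarrow> bracket K H x \<in> U'" for U'
      proof -
        have "P U'" using that U unfolding P_def by blast
        then show ?thesis
          using subspace_dim_equal[of U' U] least that(1,2) U unfolding P_def by blast
      qed
    qed (use U in \<open>auto simp: P_def\<close>)
    have "x \<in> W" unfolding W_def using x(3) by (rule span_base)
    moreover have "x \<in> kf.orth_complement W" using x(1) U unfolding P_def by blast
    ultimately have "kform K x x = 0" unfolding kf.orth_complement_def by blast
    then show False using kf.eq_0_iff x(2) by blast
  qed
  then show ?thesis using kf.orth_complement_trivial[of W] unfolding W_def by simp
qed

text \<open>A root vanishes nowhere on the connected open chamber, so it has a constant sign there.\<close>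

lemma root_or_uminus_positive:
  assumes "subspace t" and chamber: "closed_weyl_chamber K t tp" and \<alpha>: "\<alpha> \<in> roots K t"
  shows "\<alpha> \<in> positive_roots K t tp \<or> - \<alpha> \<in> positive_roots K t tp"
proof -
  obtain C where C: "C \<in> components {H\<in>t. \<forall>\<alpha>\<in>roots K t. kform K \<alpha> H \<noteq> 0}" "tp = closure C"
    using chamber unfolding closed_weyl_chamber_def by blast
  have cont: "continuous_on S (kform K \<alpha>)" for S
    using kf.lin_right linear_continuous_on linear_conv_bounded_linear by blast
  have nz: "kform K \<alpha> H \<noteq> 0" if "H \<in> C" for H using in_components_subset[OF C(1)] \<alpha> that by blast
  have "connected (kform K \<alpha> ` C)"
    using in_components_connected[OF C(1)] cont by (intro connected_continuous_image)
  then have int: "z \<in> kform K \<alpha> ` C"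
    if "x \<in> kform K \<alpha> ` C" "y \<in> kform K \<alpha> ` C" "x \<le> z" "z \<le> y" for x y z
    using connectedD_interval that by blast
  have "(\<forall>H\<in>C. kform K \<alpha> H \<ge> 0) \<or> (\<forall>H\<in>C. kform K \<alpha> H \<le> 0)"
  proof (rule ccontr)
    assume "\<not> ?thesis"
    then obtain H H' where "H \<in> C" "H' \<in> C" "kform K \<alpha> H < 0" "kform K \<alpha> H' > 0"
      by (meson not_le)
    then have "0 \<in> kform K \<alpha> ` C" using int[of "kform K \<alpha> H" "kform K \<alpha> H'" 0] by auto
    then show False using nz by auto
  qed
  moreover have "\<forall>H\<in>tp. kform K \<alpha> H \<ge> 0" if "\<forall>H\<in>C. kform K \<alpha> H \<ge> 0"
    unfolding C(2) using that cont continuous_ge_on_closure[of C "kform K \<alpha>"] by blast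
  moreover have "\<forall>H\<in>tp. kform K \<alpha> H \<le> 0" if "\<forall>H\<in>C. kform K \<alpha> H \<le> 0"
    unfolding C(2) using that cont continuous_le_on_closure[of C "kform K \<alpha>"] by blast
  ultimately show ?thesis
    unfolding positive_roots_def using \<alpha> uminus_root[OF assms(1) \<alpha>] by (auto simp: kf.B_simps)
qed

end

section \<open>Representations\<close>

lemma linear_sandwich: "linear (\<lambda>A :: complex^'n^'n. P *v (A *v u))"
proof (rule linearI)
  show "P *v ((A + B) *v u) = P *v (A *v u) + P *v (B *v u)" for A B :: "complex^'n^'n"
    by (simp add: matrix_vector_mult_add_rdistrib matrix_vector_right_distrib)
  show "P *v ((r *\<^sub>R A) *v u) = r *\<^sub>R (P *v (A *v u))" for r and A :: "complex^'n^'n"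
    by (simp add: vec_eq_iff matrix_vector_mult_def scaleR_sum_right[symmetric])
qed

lemma linear_matrix_vector_mult_left: "linear (\<lambda>A :: complex^'n^'n. A *v u)"
  using linear_sandwich[of "mat 1" u] by simp

context lie_group
begin

lemma lie_rep_differentiable:
  assumes "lie_rep K \<rho>"
  shows "differentiable_at_one \<rho>"
  using assms id_chart(1) e0_mem smooth_on_differentiable
  unfolding lie_rep_def smooth_map_on_group_def differentiable_at_one_def by blast

lemma lie_rep_vector_has_derivative:
  assumes "lie_rep K \<rho>"
  shows "((\<lambda>a. P *v (\<rho> (\<psi> a) *v u)) has_derivative (\<lambda>X. P *v (deriv_at_one K \<rho> X *v u))) (at e0)"
proof -
  have "bounded_linear (\<lambda>A :: complex^'a^'a. P *v (A *v u))"
    using linear_sandwich by (simp add: linear_conv_bounded_linear)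
  from bounded_linear.has_derivative[OF this deriv_at_one_works[OF lie_rep_differentiable[OF assms]]]
  show ?thesis by (simp add: o_def)
qed

lemma deriv_rep_Ad:
  assumes \<rho>: "lie_rep K \<rho>" and k: "k \<in> carrier K"
  shows "\<rho> k *v (deriv_at_one K \<rho> (Ad K (inv k) X) *v u) = deriv_at_one K \<rho> X *v (\<rho> k *v u)"
proof -
  have hom: "\<rho> (g \<otimes> h) = \<rho> g ** \<rho> h" if "g \<in> carrier K" "h \<in> carrier K" for g h
    using \<rho> that unfolding lie_rep_def by blast
  have one: "\<rho> \<one> = mat 1" using \<rho> unfolding lie_rep_def by blast
  have "\<rho> k ** \<rho> (inv k) = mat 1" using hom[of k "inv k"] k one by simp
  then have inv: "\<rho> k *v (\<rho> (inv k) *v w) = w" for w by (simp add: matrix_vector_mul_assoc)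
  have l: "deriv_at_one K (\<lambda>x. \<rho> x *v w) = (\<lambda>X. deriv_at_one K \<rho> X *v w)" for w
    by (rule deriv_at_one_eq) (use lie_rep_vector_has_derivative[OF \<rho>, of "mat 1" w] in \<open>simp add: o_def\<close>)
  have d': "differentiable_at_one (\<lambda>x. \<rho> x *v u)"
    unfolding differentiable_at_one_def differentiable_def o_def
    using lie_rep_vector_has_derivative[OF \<rho>, of "mat 1" u] by auto
  have "deriv_at_one K (\<lambda>x. \<rho> x *v u) (Ad K (inv k) X)
      = deriv_at_one K (\<lambda>x. \<rho> (inv k \<otimes> x \<otimes> inv (inv k)) *v u) X"
    using deriv_at_one_conj[OF d', of "inv k" X] k by simp
  also have "\<dots> = deriv_at_one K (\<lambda>x. \<rho> (inv k) *v (\<rho> x *v (\<rho> k *v u))) X"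
    using k by (intro fun_cong[OF deriv_at_one_cong]) (simp add: hom matrix_vector_mul_assoc matrix_mul_assoc)
  also have "\<dots> = \<rho> (inv k) *v (deriv_at_one K \<rho> X *v (\<rho> k *v u))"
    by (intro fun_cong[OF deriv_at_one_eq])
      (use lie_rep_vector_has_derivative[OF \<rho>, of "\<rho> (inv k)" "\<rho> k *v u"] in \<open>simp add: o_def\<close>)
  finally show ?thesis by (simp add: l inv)
qed

lemma lie_rep_continuous:
  assumes "lie_rep K \<rho>"
  shows "continuous_map (gtop K) euclidean \<rho>"
proof (rule pasting_lemma[of "atlas K" "gtop K" fst euclidean "\<lambda>_. \<rho>"])
  fix c assume c: "c \<in> atlas K"
  show "openin (gtop K) (fst c)" by (rule chart_open_dom[OF c])
  have "Ck_on 0 (\<rho> \<circ> chart_inv c) (chart_image c)"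
    using assms c unfolding lie_rep_def smooth_map_on_group_def smooth_on_def by blast
  then have "continuous_map (top_of_set (chart_image c)) euclidean (\<rho> \<circ> chart_inv c)" by simp
  from continuous_map_compose[OF homeomorphic_imp_continuous_map[OF chart_homeo[OF c]] this]
  have *: "continuous_map (subtopology (gtop K) (fst c)) euclidean ((\<rho> \<circ> chart_inv c) \<circ> snd c)" .
  show "continuous_map (subtopology (gtop K) (fst c)) euclidean \<rho>"
    by (rule continuous_map_eq[OF *]) (simp add: chart_inv_of[OF c])
next
  fix x assume "x \<in> topspace (gtop K)"
  then show "\<exists>c. c \<in> atlas K \<and> x \<in> fst c \<and> \<rho> x = \<rho> x"
    using cover unfolding topspace_eq by blast
qed simp

lemma irreducible_orbit_spans:
  assumes \<rho>: "irreducible_rep K \<rho>" and v: "v \<noteq> 0"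
  shows "vec.span ((\<lambda>g. \<rho> g *v v) ` carrier K) = UNIV"
proof -
  have rep: "lie_rep K \<rho>" and irr: "\<And>W. vec.subspace W \<Longrightarrow> (\<And>g w. g \<in> carrier K \<Longrightarrow> w \<in> W \<Longrightarrow> \<rho> g *v w \<in> W)
      \<Longrightarrow> W = {0} \<or> W = UNIV"
    using \<rho> unfolding irreducible_rep_def by blast+
  let ?Z = "(\<lambda>g. \<rho> g *v v) ` carrier K"
  have "\<rho> g *v w \<in> vec.span ?Z" if g: "g \<in> carrier K" and "w \<in> vec.span ?Z" for g w
    using that(2)
  proof (induction rule: vec.span_induct_alt)
    case base
    show ?case by (simp add: vec.span_zero)
  next
    case (step c z w)
    obtain h where h: "h \<in> carrier K" "z = \<rho> h *v v" using step(1) by blast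
    then have "\<rho> g *v z = \<rho> (g \<otimes> h) *v v"
      using rep g unfolding lie_rep_def by (simp add: matrix_vector_mul_assoc)
    then have "\<rho> g *v z \<in> ?Z" using g h(1) by blast
    then have "c *s (\<rho> g *v z) + \<rho> g *v w \<in> vec.span ?Z"
      by (intro vec.span_add vec.span_scale vec.span_base step)
    then show ?case by (simp add: matrix_vector_right_distrib vector_scalar_commute)
  qed
  then have "vec.span ?Z = {0} \<or> vec.span ?Z = UNIV" by (intro irr) auto
  moreover have "\<rho> \<one> *v v \<in> vec.span ?Z" by (intro vec.span_base imageI) simp
  then have "v \<in> vec.span ?Z" using rep unfolding lie_rep_def by simp
  ultimately show ?thesis using v by auto
qed

end

context compact_semisimple_lie_group
begin

text \<open>Infinitesimal form of the fact that the cone over the \<open>K\<close>-orbit of a highest weight line is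
  stable under the complexified group: multiplication by \<open>\<i>\<close> turns \<open>d\<rho>(X) v\<close> into a vector tangent
  to that cone, with radial part \<open>- (\<mu>|X)\<close>.  For \<open>X\<close> in \<open>t\<close> this is the weight equation; for a
  root vector the highest weight condition exchanges real and imaginary part of \<open>X + \<i>Y\<close>.\<close>

lemma highest_weight_tangent:
  assumes t: "maximal_abelian K t" and chamber: "closed_weyl_chamber K t tp" and "\<mu> \<in> t"
    and \<rho>: "lie_rep K \<rho>"
    and weight: "\<And>H. H \<in> t \<Longrightarrow> deriv_at_one K \<rho> H *v v = (\<i> * complex_of_real (kform K \<mu> H)) *s v"
    and highest: "\<And>\<alpha> X Y. \<alpha> \<in> positive_roots K t tp \<Longrightarrow> in_root_space K t \<alpha> X Y \<Longrightarrow>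
        deriv_at_one K \<rho> X *v v + \<i> *s (deriv_at_one K \<rho> Y *v v) = 0"
  shows "\<exists>Y. \<i> *s (deriv_at_one K \<rho> X *v v) =
    deriv_at_one K \<rho> Y *v v - complex_of_real (kform K \<mu> X) *s v"
proof -
  have ab: "abelian_subalgebra K t" and sub: "subspace t"
    using t unfolding maximal_abelian_def abelian_subalgebra_def by auto
  define L where "L X = deriv_at_one K \<rho> X *v v" for X
  have L: "linear L"
    using linear_compose[OF linear_deriv_at_one[OF lie_rep_differentiable[OF \<rho>]]
        linear_matrix_vector_mult_left[of v]] unfolding L_def o_def .
  define D where "D = {X. \<exists>Y. \<i> *s L X = L Y - complex_of_real (kform K \<mu> X) *s v}"
  have "subspace D"
    unfolding subspace_def
  proof (intro conjI ballI allI)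
    show "0 \<in> D"
      unfolding D_def by (auto simp: linear_0[OF L] kf.B_simps intro!: exI[of _ 0])
  next
    fix X X' assume "X \<in> D" "X' \<in> D"
    then obtain Y Y' where "\<i> *s L X = L Y - complex_of_real (kform K \<mu> X) *s v"
      "\<i> *s L X' = L Y' - complex_of_real (kform K \<mu> X') *s v"
      unfolding D_def by blast
    then have "\<i> *s L (X + X') = L (Y + Y') - complex_of_real (kform K \<mu> (X + X')) *s v"
      by (simp add: linear_add[OF L] kf.B_simps vector_add_ldistrib vector_sadd_rdistrib)
    then show "X + X' \<in> D" unfolding D_def by blast
  next
    fix r X assume "X \<in> D"
    then obtain Y where Y: "\<i> *s L X = L Y - complex_of_real (kform K \<mu> X) *s v"
      unfolding D_def by blast
    have "\<i> *s L (r *\<^sub>R X) = r *\<^sub>R (\<i> *s L X)"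
      by (simp add: linear_scale[OF L] vec_eq_iff)
    also have "\<dots> = L (r *\<^sub>R Y) - complex_of_real (kform K \<mu> (r *\<^sub>R X)) *s v"
      unfolding Y by (simp add: linear_scale[OF L] kf.B_simps vec_eq_iff algebra_simps
          scaleR_conv_of_real[where 'a = complex])
    finally show "r *\<^sub>R X \<in> D" unfolding D_def by blast
  qed
  moreover have "X \<in> D" if "X \<in> t" for X
  proof -
    have "\<i> *s L X = L 0 - complex_of_real (kform K \<mu> X) *s v"
      using weight[OF that] by (simp add: L_def[of X] linear_0[OF L] vec_eq_iff mult.assoc[symmetric])
    then show ?thesis unfolding D_def by blast
  qed
  moreover have "X \<in> D" if X: "X \<in> root_vectors t" for X
  proof -
    obtain \<alpha> Y where \<alpha>: "\<alpha> \<in> roots K t" "in_root_space K t \<alpha> X Y"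
      using X unfolding root_vectors_def by blast
    have "\<exists>Z. L X + \<i> *s L Z = 0"
      using root_or_uminus_positive[OF sub chamber \<alpha>(1)]
    proof
      assume "\<alpha> \<in> positive_roots K t tp"
      from highest[OF this \<alpha>(2)] show ?thesis unfolding L_def by blast
    next
      assume "- \<alpha> \<in> positive_roots K t tp"
      from highest[OF this, of X "- Y"] show ?thesis
        using \<alpha>(2) in_root_space_swap(2) unfolding L_def by blast
    qed
    then obtain Z where "L X + \<i> *s L Z = 0" by blast
    then have "\<i> *s L X = L Z"
      by (simp add: vec_eq_iff) (metis add_eq_0_iff complex_i_mult_minus minus_minus mult_minus_right)
    then show ?thesis
      unfolding D_def using kform_root_vector[OF ab \<open>\<mu> \<in> t\<close> X] by auto
  qed
  ultimately have "span (t \<union> root_vectors t) \<subseteq> D" by (intro span_minimal) auto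
  then have "X \<in> D" using root_space_decomposition[OF t] by blast
  then show ?thesis unfolding D_def L_def by blast
qed

lemma compact_maximum_on_tuples:
  fixes d :: nat
  assumes F: "multiform d F" and \<rho>: "lie_rep K \<rho>"
  obtains k where "\<And>j. j < d \<Longrightarrow> k j \<in> carrier K"
    "\<And>h. (\<And>j. j < d \<Longrightarrow> h j \<in> carrier K) \<Longrightarrow> norm (F (\<lambda>j. \<rho> (h j) *v v)) \<le> norm (F (\<lambda>j. \<rho> (k j) *v v))"
proof -
  let ?X = "product_topology (\<lambda>_. gtop K) {..<d}"
  define f where "f h = norm (F (\<lambda>j. \<rho> (h j) *v v))" for h
  have "continuous_map ?X euclidean (\<lambda>h. \<rho> (h j) *v v)" if "j < d" for j
  proof -
    have p: "continuous_map ?X (gtop K) (\<lambda>h. h j)"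
      using that by (intro continuous_map_product_projection) auto
    have l: "continuous_map euclidean euclidean (\<lambda>A :: complex^'a^'a. A *v v)"
    proof -
      have "bounded_linear (\<lambda>A :: complex^'a^'a. A *v v)"
        using linear_matrix_vector_mult_left by (simp add: linear_conv_bounded_linear)
      from linear_continuous_on[OF this] show ?thesis by simp
    qed
    show ?thesis
      using continuous_map_compose[OF continuous_map_compose[OF p lie_rep_continuous[OF \<rho>]] l]
      by (simp add: o_def)
  qed
  then have "continuous_map ?X euclidean (\<lambda>h. F (\<lambda>j. \<rho> (h j) *v v))"
    by (rule continuous_map_multiform[OF F])
  from continuous_map_compose[OF this, of euclideanreal norm]
  have cont: "continuous_map ?X euclideanreal f"
    unfolding f_def[abs_def] by (simp add: o_def continuous_on_norm_id)
  have "compact_space ?X" using compact by (simp add: compact_space_product_topology)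
  then have "compactin euclideanreal (f ` topspace ?X)"
    using image_compactin[OF _ cont] unfolding compact_space_def by blast
  then have c: "compact (f ` topspace ?X)" by simp
  have top: "h \<in> topspace ?X \<longleftrightarrow> h \<in> PiE {..<d} (\<lambda>_. carrier K)" for h
    by (simp add: topspace_eq)
  have "(\<lambda>j\<in>{..<d}. \<one>) \<in> topspace ?X" unfolding top by simp
  then have "f ` topspace ?X \<noteq> {}" by blast
  from compact_attains_sup[OF c this]
  obtain k where k: "k \<in> topspace ?X" "\<And>h. h \<in> topspace ?X \<Longrightarrow> f h \<le> f k" by blast
  show ?thesis
  proof (rule that[of k])
    show "k j \<in> carrier K" if "j < d" for j using k(1) that unfolding top by auto
    fix h assume "\<And>j. j < d \<Longrightarrow> h j \<in> carrier K"
    then have "restrict h {..<d} \<in> topspace ?X" unfolding top by auto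
    from k(2)[OF this] have "f (restrict h {..<d}) \<le> f k" .
    moreover have "f (restrict h {..<d}) = f h"
      unfolding f_def by (intro arg_cong[of _ _ norm] multiform_cong[OF F]) simp
    ultimately show "norm (F (\<lambda>j. \<rho> (h j) *v v)) \<le> norm (F (\<lambda>j. \<rho> (k j) *v v))"
      by (simp add: f_def)
  qed
qed

text \<open>At a point \<open>y = (\<rho>(k\<^sub>1) v, \<dots>, \<rho>(k\<^sub>d) v)\<close> where \<open>|F|\<close> is maximal on the \<open>d\<close>-fold product of the
  orbit, the value is nonzero because the orbit spans.  Infinitesimal invariance of \<open>F\<close> under
  \<open>X\<close> says that the sum over all slots of \<open>F\<close> with \<open>y\<^sub>i\<close> replaced by \<open>d\<rho>(X) y\<^sub>i\<close> is zero; as \<open>F\<close> is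
  complex multilinear, so is the sum with \<open>\<i> d\<rho>(X) y\<^sub>i\<close>.  By \<open>tangent\<close> the latter vector is
  a tangent vector of the orbit minus \<open>(Ad k\<^sub>i \<mu>|X) y\<^sub>i\<close>.  Maximality makes the tangent part
  contribute nothing to the real part after multiplication by the conjugate of \<open>F y\<close>, and what
  remains is \<open>- |F y|\<^sup>2\<close> times the pairing of the sum of the \<open>Ad k\<^sub>i \<mu>\<close> with \<open>X\<close>.\<close>

lemma invariant_form_orbit_sum_zero:
  assumes F: "multiform d F"
    and inv: "\<And>g y. g \<in> carrier K \<Longrightarrow> F (\<lambda>j. \<rho> g *v y j) = F y"
    and nz: "F y0 \<noteq> 0"
    and \<rho>: "irreducible_rep K \<rho>" and v: "v \<noteq> 0"
    and tangent: "\<And>X. \<exists>Y. \<i> *s (deriv_at_one K \<rho> X *v v) =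
      deriv_at_one K \<rho> Y *v v - complex_of_real (kform K \<mu> X) *s v"
  obtains k where "\<And>j. j < d \<Longrightarrow> k j \<in> carrier K" "(\<Sum>j<d. Ad K (k j) \<mu>) = 0"
proof -
  have rep: "lie_rep K \<rho>" using \<rho> unfolding irreducible_rep_def by blast
  have hom: "\<rho> (g \<otimes> h) = \<rho> g ** \<rho> h" if "g \<in> carrier K" "h \<in> carrier K" for g h
    using rep that unfolding lie_rep_def by blast
  have \<rho>1: "\<rho> \<one> = mat 1" using rep unfolding lie_rep_def by blast
  obtain k where k: "\<And>j. j < d \<Longrightarrow> k j \<in> carrier K"
    and mx: "\<And>h. (\<And>j. j < d \<Longrightarrow> h j \<in> carrier K) \<Longrightarrow>
      norm (F (\<lambda>j. \<rho> (h j) *v v)) \<le> norm (F (\<lambda>j. \<rho> (k j) *v v))"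
    using compact_maximum_on_tuples[OF F rep, of v] by blast
  define y where "y j = \<rho> (k j) *v v" for j
  define c where "c = F y"
  have "c \<noteq> 0"
  proof
    assume "c = 0"
    have "F z = 0" if z: "\<And>j. j < d \<Longrightarrow> z j \<in> (\<lambda>g. \<rho> g *v v) ` carrier K" for z
    proof -
      have "\<forall>j. \<exists>g. j < d \<longrightarrow> g \<in> carrier K \<and> z j = \<rho> g *v v" using z by blast
      then obtain h where h: "\<And>j. j < d \<Longrightarrow> h j \<in> carrier K \<and> z j = \<rho> (h j) *v v" by metis
      have "F z = F (\<lambda>j. \<rho> (h j) *v v)" using h by (intro multiform_cong[OF F]) blast
      moreover have "norm (F (\<lambda>j. \<rho> (h j) *v v)) \<le> 0"
        using mx[of h] h \<open>c = 0\<close> by (simp add: c_def y_def[abs_def])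
      ultimately show ?thesis by simp
    qed
    then show False
      using multiform_eq_0_of_span[OF F irreducible_orbit_spans[OF \<rho> v]] nz by blast
  qed
  define G where "G i z = F (y(i := z))" for i z
  have G_add: "G i (a + b) = G i a + G i b" if "i < d" for i a b
    unfolding G_def by (rule multiform_add_slot[OF F that])
  have G_scale: "G i (s *s a) = s * G i a" if "i < d" for i s a
    unfolding G_def by (rule multiform_scale_slot[OF F that])
  have G_self: "G i (y i) = c" for i unfolding G_def c_def by simp
  let ?d = "deriv_at_one K \<rho>"

  \<comment> \<open>Moving one slot along the orbit cannot increase \<open>|F|\<close>.\<close>
  have stationary: "Re (cnj c * G i (\<rho> (k i) *v (?d Y *v v))) = 0" if i: "i < d" for i Y
  proof -
    define q where "q a = (cmod (G i (\<rho> (k i) *v (\<rho> (\<psi> a) *v v))))\<^sup>2" for a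
    have slot: "((\<lambda>a. G i (\<rho> (k i) *v (\<rho> (\<psi> a) *v v))) has_derivative
        (\<lambda>Y. G i (\<rho> (k i) *v (?d Y *v v)))) (at e0)"
    proof -
      have lin: "linear (G i)"
      proof (rule linearI)
        show "G i (r *\<^sub>R a) = r *\<^sub>R G i a" for r a
        proof -
          have "r *\<^sub>R a = complex_of_real r *s a"
            by (simp add: vec_eq_iff scaleR_conv_of_real[where 'a = complex])
          then show ?thesis by (simp add: G_scale[OF i] scaleR_conv_of_real[where 'a = complex])
        qed
      qed (rule G_add[OF i])
      then have "bounded_linear (G i)" by (simp add: linear_conv_bounded_linear)
      from bounded_linear.has_derivative[OF this lie_rep_vector_has_derivative[OF rep]] show ?thesis .
    qed
    have e0c: "G i (\<rho> (k i) *v (\<rho> (\<psi> e0) *v v)) = c"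
      using G_self[of i] by (simp add: \<psi>_e0 \<rho>1 y_def)
    have dq: "(q has_derivative (\<lambda>Y. 2 * Re (cnj c * G i (\<rho> (k i) *v (?d Y *v v))))) (at e0)"
    proof -
      have "((\<lambda>a. (\<lambda>z. z \<bullet> z) (G i (\<rho> (k i) *v (\<rho> (\<psi> a) *v v)))) has_derivative
        (\<lambda>Y. c \<bullet> G i (\<rho> (k i) *v (?d Y *v v)) + G i (\<rho> (k i) *v (?d Y *v v)) \<bullet> c)) (at e0)"
        using has_derivative_inner[OF slot slot] unfolding e0c .
      then show ?thesis
        unfolding q_def[abs_def] power2_norm_eq_inner
        by (simp add: inner_complex_def algebra_simps)
    qed
    have "q a \<le> q e0" if a: "a \<in> E" for a
    proof -
      define h where "h = k(i := k i \<otimes> \<psi> a)"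
      have h: "h j \<in> carrier K" if "j < d" for j
        using that k i a by (auto simp: h_def \<psi>_carrier)
      have "(\<lambda>j. \<rho> (h j) *v v) = y(i := \<rho> (k i) *v (\<rho> (\<psi> a) *v v))"
        using k[OF i] a by (auto simp: h_def y_def fun_eq_iff hom \<psi>_carrier matrix_vector_mul_assoc)
      moreover have "cmod (F (\<lambda>j. \<rho> (h j) *v v)) \<le> cmod c"
        unfolding c_def y_def[abs_def] by (rule mx) (rule h)
      ultimately have "cmod (G i (\<rho> (k i) *v (\<rho> (\<psi> a) *v v))) \<le> cmod c"
        by (simp only: G_def)
      then show ?thesis unfolding q_def e0c by (intro power_mono) auto
    qed
    then have "(\<lambda>Y. 2 * Re (cnj c * G i (\<rho> (k i) *v (?d Y *v v)))) = (\<lambda>_. 0)"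
      by (intro differential_zero_maxmin[OF e0_mem open_E dq]) blast
    then show ?thesis by (metis mult_eq_0_iff zero_neq_numeral)
  qed

  have infinitesimal: "(\<Sum>i<d. G i (?d X *v y i)) = 0" for X
  proof -
    have "((\<lambda>a. \<rho> (\<psi> a) *v y j) has_derivative (\<lambda>X. ?d X *v y j)) (at e0)" for j
      using lie_rep_vector_has_derivative[OF rep, of "mat 1" "y j"] by simp
    then have "((\<lambda>a. F (\<lambda>j. \<rho> (\<psi> a) *v y j)) has_derivative
        (\<lambda>X. \<Sum>i<d. F ((\<lambda>j. \<rho> (\<psi> e0) *v y j)(i := ?d X *v y i)))) (at e0)"
      by (rule multiform_has_derivative[OF F])
    then have "((\<lambda>a. c) has_derivative (\<lambda>X. \<Sum>i<d. G i (?d X *v y i))) (at e0)"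
      unfolding \<psi>_e0 \<rho>1 matrix_vector_mul_lid G_def
      by (rule has_derivative_transform_within_open[OF _ open_E e0_mem]) (simp add: inv \<psi>_carrier c_def)
    from has_derivative_unique[OF this has_derivative_const] show ?thesis by metis
  qed

  have pairing: "(\<Sum>i<d. kform K (Ad K (k i) \<mu>) X) = 0" for X
  proof -
    have "\<forall>i. \<exists>Y. \<i> *s (?d (Ad K (inv (k i)) X) *v v) =
        ?d Y *v v - complex_of_real (kform K \<mu> (Ad K (inv (k i)) X)) *s v"
      using tangent by blast
    then obtain Y where Y: "\<And>i. \<i> *s (?d (Ad K (inv (k i)) X) *v v) =
        ?d (Y i) *v v - complex_of_real (kform K \<mu> (Ad K (inv (k i)) X)) *s v"
      by metis
    define r where "r i = kform K (Ad K (k i) \<mu>) X" for i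
    have r: "kform K \<mu> (Ad K (inv (k i)) X) = r i" if "i < d" for i
      using kform_Ad[OF k[OF that], of \<mu> "Ad K (inv (k i)) X"] k[OF that]
      by (simp add: r_def Ad_inv_cancel)
    have slot_eq: "\<i> * G i (?d X *v y i) = G i (\<rho> (k i) *v (?d (Y i) *v v)) - complex_of_real (r i) * c"
      if i: "i < d" for i
    proof -
      have "\<i> *s (?d X *v y i) = \<rho> (k i) *v (\<i> *s (?d (Ad K (inv (k i)) X) *v v))"
        unfolding y_def deriv_rep_Ad[OF rep k[OF i], symmetric] by (simp add: vector_scalar_commute)
      also have "\<dots> = \<rho> (k i) *v (?d (Y i) *v v) + (- complex_of_real (r i)) *s y i"
        unfolding Y r[OF i]
        by (simp add: y_def matrix_vector_mult_diff_distrib vector_scalar_commute vec_eq_iff)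
      finally have "G i (\<i> *s (?d X *v y i)) =
          G i (\<rho> (k i) *v (?d (Y i) *v v) + (- complex_of_real (r i)) *s y i)" by simp
      then show ?thesis by (simp only: G_add[OF i] G_scale[OF i] G_self) simp
    qed
    have "0 = Re (cnj c * (\<i> * (\<Sum>i<d. G i (?d X *v y i))))" by (simp add: infinitesimal)
    also have "\<dots> = (\<Sum>i<d. Re (cnj c * (\<i> * G i (?d X *v y i))))"
      by (simp only: sum_distrib_left Re_sum)
    also have "\<dots> = (\<Sum>i<d. - r i * (cmod c)\<^sup>2)"
    proof (rule sum.cong[OF refl])
      fix i assume "i \<in> {..<d}"
      then have i: "i < d" by simp
      have "cnj c * (\<i> * G i (?d X *v y i)) =
          cnj c * G i (\<rho> (k i) *v (?d (Y i) *v v)) - complex_of_real (r i) * (c * cnj c)"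
        unfolding slot_eq[OF i] by (simp add: algebra_simps)
      then show "Re (cnj c * (\<i> * G i (?d X *v y i))) = - r i * (cmod c)\<^sup>2"
        using stationary[OF i, of "Y i"] by (simp add: complex_norm_square[symmetric] del: of_real_power)
    qed
    also have "\<dots> = - (\<Sum>i<d. r i) * (cmod c)\<^sup>2"
      by (simp add: sum_distrib_right sum_negf)
    finally show ?thesis using \<open>c \<noteq> 0\<close> by (simp add: r_def)
  qed
  have "kform K (\<Sum>i<d. Ad K (k i) \<mu>) (\<Sum>i<d. Ad K (k i) \<mu>) = 0"
    unfolding linear_sum[OF kf.lin_left] by (rule pairing)
  then have "(\<Sum>i<d. Ad K (k i) \<mu>) = 0" using kf.eq_0_iff by blast
  then show ?thesis using that k by blast
qed

end

section \<open>The bound for the partial convex hull\<close>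

lemma zero_in_partial_convex_hull:
  fixes x :: "nat \<Rightarrow> 'e::real_vector"
  assumes "d > 0" "\<And>j. j < d \<Longrightarrow> x j \<in> S" "(\<Sum>j<d. x j) = 0"
  shows "0 \<in> partial_convex_hull d S"
proof -
  have "(\<Sum>j<d. (1 / real d) *\<^sub>R x j) \<in> convex hull (x ` {..<d})"
    using assms(1) by (intro convex_sum) (auto intro: hull_inc)
  then have "0 \<in> convex hull (x ` {..<d})"
    using assms(3) by (simp add: scaleR_right.sum[symmetric])
  then show ?thesis unfolding partial_convex_hull_def using assms(2) by blast
qed

theorem theorem1p1:
  fixes K :: "('g, 'e::euclidean_space) lie_struct"
    and t tp :: "'e set"
    and l :: 'e
    and q :: rat
    and \<rho> :: "'g \<Rightarrow> complex^'n^'n"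
  assumes "lie_group K"
    and "compact_space (gtop K)"
    and "connected_space (gtop K)"
    and "semisimple K"
    and "maximal_abelian K t"
    and "closed_weyl_chamber K t tp"
    and "l \<in> dominant_weights K t tp - {0}"
    and "q > 0"
    and "of_rat q *\<^sub>R l \<in> dominant_weights K t tp"
    and "irreducible_rep K \<rho>"
    and "has_highest_weight K t tp \<rho> (of_rat q *\<^sub>R l)"
    and "invariant_degrees K \<rho> \<noteq> {}"
  shows "r0 K l \<le> d1 K \<rho>"
proof -
  interpret compact_semisimple_lie_group K
    using assms(1,2,4)
    unfolding compact_semisimple_lie_group_def compact_semisimple_lie_group_axioms_def by blast
  let ?\<mu> = "of_rat q *\<^sub>R l"
  define d where "d = d1 K \<rho>"
  have "d \<in> invariant_degrees K \<rho>"
    unfolding d_def d1_def using assms(12) by (metis LeastI ex_in_conv)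
  then have "d > 0" and "invariant_polys K \<rho> d \<noteq> {\<lambda>_. 0}"
    unfolding invariant_degrees_def by auto
  moreover have "(\<lambda>_. 0) \<in> invariant_polys K \<rho> d"
    unfolding invariant_polys_def homogeneous_polys_def
    by (auto intro!: exI[of _ "\<lambda>_. 0"])
  ultimately obtain f where f: "f \<in> invariant_polys K \<rho> d" "f \<noteq> (\<lambda>_. 0)" by blast
  then obtain z where "f z \<noteq> 0" by auto
  have hom: "f \<in> homogeneous_polys d" and inv: "\<And>g z. g \<in> carrier K \<Longrightarrow> f (\<rho> g *v z) = f z"
    using f unfolding invariant_polys_def by auto
  have nz: "polarization d f (\<lambda>_. z) \<noteq> 0"
    using \<open>f z \<noteq> 0\<close> finite_self_surjections[of d] self_surjections_nonempty[of d]
    by (simp add: polarization_homogeneous(2)[OF hom])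
  have pinv: "polarization d f (\<lambda>j. \<rho> g *v y j) = polarization d f y" if "g \<in> carrier K" for g y
    using inv[OF that] by (rule polarization_invariant)
  obtain v where v: "v \<noteq> 0"
    and weight: "\<And>H. H \<in> t \<Longrightarrow> deriv_at_one K \<rho> H *v v = (\<i> * complex_of_real (kform K ?\<mu> H)) *s v"
    and highest: "\<And>\<alpha> X Y. \<alpha> \<in> positive_roots K t tp \<Longrightarrow> in_root_space K t \<alpha> X Y \<Longrightarrow>
        deriv_at_one K \<rho> X *v v + \<i> *s (deriv_at_one K \<rho> Y *v v) = 0"
    using assms(11) unfolding has_highest_weight_def by blast
  have rep: "lie_rep K \<rho>" using assms(10) unfolding irreducible_rep_def by blast
  have "?\<mu> \<in> t" using assms(9) unfolding dominant_weights_def weight_lattice_def by blast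
  have tangent: "\<exists>Y. \<i> *s (deriv_at_one K \<rho> X *v v) =
      deriv_at_one K \<rho> Y *v v - complex_of_real (kform K ?\<mu> X) *s v" for X
    by (rule highest_weight_tangent[OF assms(5,6) \<open>?\<mu> \<in> t\<close> rep]) (erule weight, erule (1) highest)
  obtain k where k: "\<And>j. j < d \<Longrightarrow> k j \<in> carrier K" "(\<Sum>j<d. Ad K (k j) ?\<mu>) = 0"
    by (rule invariant_form_orbit_sum_zero[where d = d and F = "polarization d f" and \<rho> = \<rho>
          and v = v and \<mu> = ?\<mu> and ?y0.0 = "\<lambda>_. z"])
      (rule polarization_homogeneous(1)[OF hom], erule pinv, rule nz, rule assms(10), rule v,
        rule tangent, blast)
  have "(\<Sum>j<d. Ad K (k j) ?\<mu>) = of_rat q *\<^sub>R (\<Sum>j<d. Ad K (k j) l)"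
    unfolding scaleR_sum_right
    using k(1) by (intro sum.cong) (auto simp: linear_scale[OF linear_Ad])
  then have "(\<Sum>j<d. Ad K (k j) l) = 0" using k(2) assms(8) by simp
  then have "0 \<in> partial_convex_hull d (adjoint_orbit K l)"
    using k(1) by (intro zero_in_partial_convex_hull[OF \<open>d > 0\<close>, of "\<lambda>j. Ad K (k j) l"])
      (auto simp: adjoint_orbit_def)
  then show ?thesis
    unfolding r0_def d_def[symmetric] using \<open>d > 0\<close> by (intro Least_le) simp
qed

end
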